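(* Let $n\ge 1$ and let $k_1,\dots,k_I$ be positive integers with $k_1+\cdots+k_I=n$. In the space of real symmetric matrices of order $n$, the real codimension of the set of matrices having exactly $I$ distinct eigenvalues, with multiplicities $k_1,\dots,k_I$, is $$\frac{n(n+1)}{2}-\left[\frac{n(n-1)}{2}+I-\sum_{i=1}^I\frac{k_i(k_i-1)}{2}\right]=\frac12\sum_{i=1}^I (k_i+2)(k_i-1).$$
   Context: The space of real symmetric matrices of order $n$ is a real vector space of dimension $n(n+1)/2$. "Real dimension" of a subset is the usual dimension over $\mathbb R$ (of a real manifold, or of a semialgebraic set), and the real codimension is $n(n+1)/2$ minus the real dimension of the subset. The values of the eigenvalues are not prescribed. *)

theory Defs
  imports
    "HOL-Analysis.Analysis"
    "HOL-Homology.Invariance_of_Domain"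
    "HOL-Computational_Algebra.Polynomial"
begin

definition symmetric_matrices :: "(real^'n^'n) set" where
  "symmetric_matrices = {A. transpose A = A}"

definition eigenvalues :: "real^'n^'n \<Rightarrow> real set" where
  "eigenvalues A = {c. \<exists>v. v \<noteq> 0 \<and> A *v v = c *\<^sub>R v}"

definition char_polynomial :: "real^'n^'n \<Rightarrow> real poly" where
  "char_polynomial A = det (mat [:0, 1:] - map_matrix (\<lambda>a. [:a:]) A)"

text \<open>The multiplicity of an eigenvalue is its multiplicity as a root of the characteristic
  polynomial (for symmetric matrices this is the dimension of the eigenspace).\<close>

definition eigenvalue_multiplicity :: "real^'n^'n \<Rightarrow> real \<Rightarrow> nat" where
  "eigenvalue_multiplicity A c = Polynomial.order c (char_polynomial A)"

text \<open>The bijection \<open>\<mu>\<close> numbers the eigenvalues by \<open>1, \<dots>, m\<close> in an arbitrary order, so that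
  \<open>k 1, \<dots>, k m\<close> only matters up to permutation, and \<open>m\<close> is the exact number of eigenvalues.\<close>

definition symmetric_with_multiplicities :: "nat \<Rightarrow> (nat \<Rightarrow> nat) \<Rightarrow> (real^'n^'n) set" where
  "symmetric_with_multiplicities m k =
     {A \<in> symmetric_matrices.
        \<exists>\<mu>. bij_betw \<mu> {1..m} (eigenvalues A) \<and>
            (\<forall>i\<in>{1..m}. eigenvalue_multiplicity A (\<mu> i) = k i)}"

text \<open>The real dimension of a nonempty subset \<open>S\<close> of a Euclidean space: the largest \<open>d\<close> such that
  \<open>S\<close> contains a homeomorphic copy of \<open>\<real>\<^sup>d\<close>. By invariance of domain this is the usual dimension
  if \<open>S\<close> is a manifold (proved below), and by cell decomposition it is the usual dimension if \<open>S\<close>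
  is semialgebraic. The value for \<open>S = {}\<close> is unspecified.\<close>

definition real_dim :: "'a::euclidean_space set \<Rightarrow> nat" where
  "real_dim S = Max {d. \<exists>T\<subseteq>S. top_of_set T homeomorphic_space Euclidean_space d}"

definition real_codim :: "'a::euclidean_space set \<Rightarrow> 'a set \<Rightarrow> real" where
  "real_codim V S = real (dim V) - real (real_dim S)"

lemma Euclidean_space_injection_le:
  assumes W: "openin (Euclidean_space e) W" "W \<noteq> {}"
    and f: "continuous_map (subtopology (Euclidean_space e) W) (Euclidean_space d) f" "inj_on f W"
  shows "e \<le> d"
proof (rule ccontr)
  assume "\<not> e \<le> d"
  then have de: "d < e" by simp
  have sub: "topspace (Euclidean_space d) \<subseteq> topspace (Euclidean_space e)"
    using de by (simp only: subset_Euclidean_space)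
  have Wtop: "topspace (subtopology (Euclidean_space e) W) = W"
    using openin_subset[OF W(1)] by auto
  have fW: "f ` W \<subseteq> topspace (Euclidean_space d)"
    using continuous_map_image_subset_topspace[OF f(1)] Wtop by simp
  have "continuous_map (subtopology (Euclidean_space e) W) (Euclidean_space e) f"
    using f(1) sub unfolding cm_Euclidean_space_iff_continuous_on by blast
  then have op: "openin (Euclidean_space e) (f ` W)"
    using invariance_of_domain_Euclidean_space[OF W(1) _ f(2)] by simp
  obtain q where q: "q \<in> f ` W" using W(2) by blast
  then have q0: "\<forall>i\<ge>d. q i = 0"
    using fW by (auto simp: topspace_Euclidean_space)
  define g where "g = (\<lambda>t::real. \<lambda>i. if i < e then (if i = d then t else q i) else 0)"
  have "continuous_map euclideanreal (Euclidean_space e) g"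
    unfolding g_def continuous_map_componentwise_Euclidean_space
    by (auto intro!: continuous_intros)
  then have "open {t. g t \<in> f ` W}"
    using openin_continuous_map_preimage[OF _ op] by fastforce
  moreover have "g 0 = q" using q0 de by (auto simp: g_def fun_eq_iff)
  ultimately obtain r where r: "r > 0" "\<And>t. dist t 0 < r \<Longrightarrow> g t \<in> f ` W"
    using q unfolding open_dist by (metis mem_Collect_eq)
  have "g (r/2) \<in> f ` W" using r by (intro r(2)) (simp add: dist_norm)
  then have "g (r/2) d = 0" using fW by (auto simp: topspace_Euclidean_space)
  then show False using r(1) de by (simp add: g_def)
qed

theorem real_dim_manifold:
  fixes S :: "'a::euclidean_space set"
  assumes "S \<noteq> {}"
    and chart: "\<And>x. x \<in> S \<Longrightarrow> \<exists>U. openin (top_of_set S) U \<and> x \<in> U \<and>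
                  top_of_set U homeomorphic_space Euclidean_space d"
  shows "real_dim S = d"
proof -
  let ?D = "{d. \<exists>T\<subseteq>S. top_of_set T homeomorphic_space Euclidean_space d}"
  have le: "e \<le> d" if "e \<in> ?D" for e
  proof -
    obtain T where T: "T \<subseteq> S" "top_of_set T homeomorphic_space Euclidean_space e"
      using \<open>e \<in> ?D\<close> by auto
    obtain h where "homeomorphic_map (Euclidean_space e) (top_of_set T) h"
      using T(2) homeomorphic_space homeomorphic_space_sym by blast
    then have h: "continuous_map (Euclidean_space e) (top_of_set T) h"
      "inj_on h (topspace (Euclidean_space e))" "h ` topspace (Euclidean_space e) = T"
      by (auto simp: homeomorphic_eq_everything_map)
    obtain z where z: "z \<in> topspace (Euclidean_space e)"
      using nontrivial_Euclidean_space by fastforce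
    then have "h z \<in> S" using h(3) T(1) by auto
    then obtain U where U: "openin (top_of_set S) U" "h z \<in> U"
      and UE: "top_of_set U homeomorphic_space Euclidean_space d"
      using chart by blast
    obtain f where "homeomorphic_map (top_of_set U) (Euclidean_space d) f"
      using UE homeomorphic_space by blast
    then have f: "continuous_map (top_of_set U) (Euclidean_space d) f" "inj_on f U"
      by (auto simp: homeomorphic_eq_everything_map)
    define W where "W = {x \<in> topspace (Euclidean_space e). h x \<in> U}"
    have hS: "continuous_map (Euclidean_space e) (top_of_set S) h"
      using h(1) T(1) by (auto simp: continuous_map_in_subtopology)
    have "openin (Euclidean_space e) W"
      unfolding W_def by (rule openin_continuous_map_preimage[OF hS U(1)])
    moreover have "W \<noteq> {}" using z U(2) by (auto simp: W_def)
    moreover have "continuous_map (subtopology (Euclidean_space e) W) (top_of_set U) h"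
      using continuous_map_from_subtopology[OF h(1), of W]
      by (auto simp: continuous_map_in_subtopology W_def)
    then have "continuous_map (subtopology (Euclidean_space e) W) (Euclidean_space d) (f \<circ> h)"
      using f(1) continuous_map_compose by blast
    moreover have "inj_on (f \<circ> h) W"
      using h(2) f(2) by (auto simp: inj_on_def W_def)
    ultimately show ?thesis by (rule Euclidean_space_injection_le)
  qed
  have "d \<in> ?D"
  proof -
    obtain x where "x \<in> S" using \<open>S \<noteq> {}\<close> by blast
    from chart[OF this] obtain U where "openin (top_of_set S) U"
      "top_of_set U homeomorphic_space Euclidean_space d" by blast
    then show ?thesis using openin_imp_subset by blast
  qed
  moreover have "finite ?D"
    unfolding finite_nat_set_iff_bounded_le using le by blast
  ultimately show ?thesis
    unfolding real_dim_def using le by (intro Max_eqI)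
qed

end

theory Submission
  imports Defs
begin

text \<open>Fix a map \<open>b\<close> on the index type whose fibres have sizes \<open>k 1, \<dots>, k m\<close>. By the spectral
  theorem the set in question consists of the matrices \<open>P D P\<^sup>T\<close> with \<open>P\<close> orthogonal and \<open>D\<close>
  diagonal, two diagonal entries of \<open>D\<close> being equal exactly if their indices lie in the same
  fibre. Let \<open>J\<close> be the set of positions above the diagonal blocks together with one diagonal
  position per block; it has \<open>m + (n\<^sup>2 - \<Sum> k\<^sub>i\<^sup>2) / 2\<close> elements, and this is the dimension.

  Upper bound: near \<open>A\<^sub>0 = P\<^sub>0 D\<^sub>0 P\<^sub>0\<^sup>T\<close> a matrix \<open>A\<close> of the set is determined by the entries of
  \<open>P\<^sub>0\<^sup>T A P\<^sub>0\<close> in \<open>J\<close>. If \<open>A x = \<lambda> x\<close> and \<open>B y = \<mu> y\<close>, then \<open>x \<bullet> (A - B) y = (\<lambda> - \<mu>) (x \<bullet> y)\<close>;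
  hence a limit \<open>H\<close> of normalised differences of members tending to \<open>A\<^sub>0\<close> acts as a scalar on each
  eigenspace of \<open>A\<^sub>0\<close>, and if the entries in \<open>J\<close> agree along the sequence, then \<open>H = 0\<close>, which is
  absurd. Eigenvectors converge because the orthogonal group is compact.

  Lower bound: with the Cayley transform \<open>P\<close> of a skew matrix \<open>K\<close> vanishing on the diagonal blocks,
  \<open>(K, D) \<mapsto> P D P\<^sup>T\<close> is injective near \<open>(0, D\<^sub>0)\<close>: a limit of normalised secants yields
  \<open>D\<^sub>0 (2 K) = (2 K) D\<^sub>0 + \<Delta>\<close> with \<open>\<Delta>\<close> diagonal, so \<open>K\<close> and \<open>\<Delta>\<close> vanish.\<close>

section \<open>The spectral theorem\<close>

definition diag_matrix :: "('n \<Rightarrow> 'a::zero) \<Rightarrow> 'a^'n^'n" where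
  "diag_matrix v = (\<chi> i j. if i = j then v i else 0)"

lemma diag_matrix_nth [simp]: "diag_matrix v $ i $ j = (if i = j then v i else 0)"
  by (simp add: diag_matrix_def)

lemma matrix_mult_diag_right:
  fixes P :: "'a::semiring_1^'n^'n"
  shows "(P ** diag_matrix v) $ i $ j = P $ i $ j * v j"
  by (simp add: matrix_matrix_mult_def if_distrib cong: if_cong)

lemma matrix_mult_diag_left:
  fixes P :: "'a::semiring_1^'n^'n"
  shows "(diag_matrix v ** P) $ i $ j = v i * P $ i $ j"
  by (simp add: matrix_matrix_mult_def if_distrib if_distribR cong: if_cong)

lemma diag_matrix_vector: "(diag_matrix v *v x) $ i = v i * (x $ i :: 'a::semiring_1)"
  by (simp add: matrix_vector_mult_def if_distrib if_distribR cong: if_cong)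

lemma transpose_diag_matrix [simp]: "transpose (diag_matrix v) = diag_matrix v"
  by (simp add: transpose_def diag_matrix_def vec_eq_iff)

lemma bounded_bilinear_matrix_mult:
  "bounded_bilinear ((**) :: real^'n^'m \<Rightarrow> real^'p^'n \<Rightarrow> real^'p^'m)"
  unfolding bilinear_conv_bounded_bilinear [symmetric] bilinear_def
  by (auto intro!: linearI simp: matrix_matrix_mult_def vec_eq_iff sum.distrib
        sum_distrib_left algebra_simps)

lemmas tendsto_matrix_mult [tendsto_intros] =
  bounded_bilinear.tendsto [OF bounded_bilinear_matrix_mult]
lemmas continuous_on_matrix_mult [continuous_intros] =
  bounded_bilinear.continuous_on [OF bounded_bilinear_matrix_mult]

lemmas matrix_mult_diff_left = bounded_bilinear.diff_left [OF bounded_bilinear_matrix_mult]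
lemmas matrix_mult_diff_right = bounded_bilinear.diff_right [OF bounded_bilinear_matrix_mult]
lemmas matrix_mult_scaleR_left = bounded_bilinear.scaleR_left [OF bounded_bilinear_matrix_mult]
lemmas matrix_mult_scaleR_right = bounded_bilinear.scaleR_right [OF bounded_bilinear_matrix_mult]
lemmas matrix_mult_add_left = bounded_bilinear.add_left [OF bounded_bilinear_matrix_mult]
lemmas matrix_mult_add_right = bounded_bilinear.add_right [OF bounded_bilinear_matrix_mult]

lemma bounded_linear_transpose: "bounded_linear (transpose :: real^'n^'m \<Rightarrow> real^'m^'n)"
  unfolding linear_conv_bounded_linear [symmetric]
  by (auto intro!: linearI simp: transpose_def vec_eq_iff)

lemmas tendsto_transpose [tendsto_intros] =
  bounded_linear.tendsto [OF bounded_linear_transpose]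
lemmas continuous_on_transpose [continuous_intros] =
  bounded_linear.continuous_on [OF bounded_linear_transpose]

lemma bounded_bilinear_matrix_vector_mult:
  "bounded_bilinear ((*v) :: real^'n^'m \<Rightarrow> real^'n \<Rightarrow> real^'m)"
  unfolding bilinear_conv_bounded_bilinear [symmetric] bilinear_def
  by (auto intro!: linearI simp: matrix_vector_mult_def vec_eq_iff sum.distrib
        sum_distrib_left algebra_simps)

lemmas tendsto_matrix_vector_mult [tendsto_intros] =
  bounded_bilinear.tendsto [OF bounded_bilinear_matrix_vector_mult]

text \<open>The rows are unit vectors, which bounds the norm, and the defining equation is a closed
  condition. Compactness later provides convergent subsequences of eigenframes.\<close>

lemma compact_orthogonal_matrices: "compact {Q::real^'n^'n. orthogonal_matrix Q}"
proof -
  have "norm Q \<le> (\<Sum>i\<in>(UNIV::'n set). 1)" if "orthogonal_matrix Q" for Q :: "real^'n^'n"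
  proof -
    have "norm Q \<le> (\<Sum>i\<in>UNIV. norm (Q $ i))"
      by (simp add: norm_vec_def L2_set_le_sum)
    also have "\<dots> = (\<Sum>i\<in>(UNIV::'n set). 1)"
      using that by (intro sum.cong) (auto simp: orthogonal_matrix_orthonormal_rows row_def)
    finally show ?thesis .
  qed
  then have "bounded {Q::real^'n^'n. orthogonal_matrix Q}"
    unfolding bounded_iff by blast
  moreover have "closed {Q::real^'n^'n. orthogonal_matrix Q}"
    unfolding orthogonal_matrix by (intro closed_Collect_eq continuous_intros)
  ultimately show ?thesis by (simp add: compact_eq_bounded_closed)
qed

section \<open>Diagonalization of symmetric matrices\<close>

lemma symmetric_matrix_inner:
  fixes A :: "real^'n^'n"
  assumes "transpose A = A"
  shows "x \<bullet> (A *v y) = (A *v x) \<bullet> y"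
  by (metis assms dot_lmul_matrix transpose_matrix_vector)

text \<open>For small \<open>t\<close> of the sign of \<open>p\<close> the linear term would win.
  This replaces differentiating the Rayleigh quotient at its maximum.\<close>

lemma quadratic_le_imp_zero:
  fixes p q :: real
  assumes "\<And>t. t * p \<le> t\<^sup>2 * q"
  shows "p = 0"
proof (rule ccontr)
  assume "p \<noteq> 0"
  \<comment> \<open>The test point is \<open>t = s * p\<close>, with \<open>s\<close> so small that
    the factor \<open>s * \<bar>q\<bar>\<close> stays below 1.\<close>
  define s where "s = 1 / (\<bar>q\<bar> + 1)"
  have s: "s > 0" "s * \<bar>q\<bar> < 1" by (auto simp: s_def divide_simps)
  have "s * p\<^sup>2 \<le> s\<^sup>2 * p\<^sup>2 * q"
    using assms[of "s * p"] by (simp add: power2_eq_square mult_ac)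
  also have "\<dots> \<le> s\<^sup>2 * p\<^sup>2 * \<bar>q\<bar>"
    by (intro mult_left_mono) auto
  also have "\<dots> = (s * p\<^sup>2) * (s * \<bar>q\<bar>)"
    by (simp add: power2_eq_square mult_ac)
  also have "\<dots> < (s * p\<^sup>2) * 1"
    using s \<open>p \<noteq> 0\<close> by (intro mult_strict_left_mono) auto
  finally show False by simp
qed

text \<open>A maximiser \<open>u\<close> of the quadratic form on the unit sphere of
  \<open>V\<close> is an eigenvector: the first variation vanishes in all directions of
  \<open>V\<close> orthogonal to \<open>u\<close>.\<close>

lemma symmetric_invariant_subspace_eigenvector:
  fixes A :: "real^'n^'n"
  assumes sym: "transpose A = A" and V: "subspace V" "\<And>x. x \<in> V \<Longrightarrow> A *v x \<in> V"
    and ne: "V \<noteq> {0}"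
  obtains u c where "u \<in> V" "norm u = 1" "A *v u = c *\<^sub>R u"
proof -
  let ?K = "V \<inter> sphere 0 1"
  obtain x where x: "x \<in> V" "x \<noteq> 0" using ne subspace_0[OF V(1)] by auto
  then have "(1 / norm x) *\<^sub>R x \<in> ?K"
    using subspace_scale[OF V(1)] by auto
  then have K0: "?K \<noteq> {}" by blast
  have K: "compact ?K" using V(1) by (simp add: closed_subspace closed_Int_compact)
  have "continuous_on ?K (\<lambda>x. x \<bullet> (A *v x))"
    by (intro continuous_intros matrix_vector_mult_linear_continuous_on)
  then obtain u where u: "u \<in> ?K" and max: "\<And>y. y \<in> ?K \<Longrightarrow> y \<bullet> (A *v y) \<le> u \<bullet> (A *v u)"
    using continuous_attains_sup[OF K K0] by blast
  define c where "c = u \<bullet> (A *v u)"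
  have uu: "u \<bullet> u = 1" "u \<in> V" "norm u = 1" using u by (auto simp: dot_square_norm)
  have max': "y \<bullet> (A *v y) \<le> c * (y \<bullet> y)" if "y \<in> V" for y
  proof (cases "y = 0")
    case False
    have "(1 / norm y) *\<^sub>R y \<in> ?K"
      using that False subspace_scale[OF V(1)] by auto
    from max[OF this] have "(y \<bullet> (A *v y)) / (norm y)\<^sup>2 \<le> c"
      by (simp add: c_def matrix_vector_mult_scaleR power2_eq_square)
    then show ?thesis using False by (simp add: dot_square_norm divide_simps mult.commute)
  qed simp
  have ortho: "w \<bullet> (A *v u) = 0" if w: "w \<in> V" "w \<bullet> u = 0" for w
  proof -
    have "t * (2 * (w \<bullet> (A *v u))) \<le> t\<^sup>2 * (c * (w \<bullet> w) - w \<bullet> (A *v w))" for t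
    proof -
      have "u + t *\<^sub>R w \<in> V" using w uu V(1) by (simp add: subspace_add subspace_scale)
      from max'[OF this] show ?thesis
        using w(2) uu symmetric_matrix_inner[OF sym, of u w]
        by (simp add: inner_commute c_def matrix_vector_right_distrib matrix_vector_mult_scaleR
            inner_add_left inner_add_right power2_eq_square algebra_simps)
    qed
    from quadratic_le_imp_zero[OF this] show ?thesis by simp
  qed
  \<comment> \<open>The residual lies in \<open>V\<close> and is orthogonal to \<open>u\<close>, so
    \<open>ortho\<close> applies to the residual itself and gives
    \<open>w \<bullet> w = 0\<close>.\<close>
  define w where "w = A *v u - c *\<^sub>R u"
  have wV: "w \<in> V" using V uu by (simp add: w_def subspace_diff subspace_scale)
  have wu: "w \<bullet> u = 0"
    using uu by (simp add: w_def inner_diff_left c_def inner_commute[of "A *v u" u])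
  have "w \<bullet> w = w \<bullet> (A *v u) - c * (w \<bullet> u)" by (simp add: w_def inner_diff_right)
  then have "w = 0" using ortho[OF wV wu] wu by simp
  then show thesis using that uu by (simp add: w_def)
qed

text \<open>Split off one unit eigenvector \<open>u\<close>. By symmetry its orthogonal complement
  in \<open>V\<close> is again invariant, and it has smaller dimension.\<close>

lemma symmetric_invariant_subspace_eigenbasis:
  fixes A :: "real^'n^'n"
  assumes sym: "transpose A = A" and "subspace V" "\<And>x. x \<in> V \<Longrightarrow> A *v x \<in> V"
  shows "\<exists>B \<subseteq> V. pairwise orthogonal B \<and> span B = V \<and>
           (\<forall>u\<in>B. norm u = 1 \<and> (\<exists>c. A *v u = c *\<^sub>R u))"
  using assms(2,3)
proof (induction "dim V" arbitrary: V rule: less_induct)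
  case less
  show ?case
  proof (cases "V = {0}")
    case True
    then show ?thesis by (intro exI[of _ "{}"]) auto
  next
    case False
    obtain u c where u: "u \<in> V" "norm u = 1" "A *v u = c *\<^sub>R u"
      using symmetric_invariant_subspace_eigenvector[OF sym less.prems False] by blast
    have uu: "u \<bullet> u = 1" using u by (simp add: dot_square_norm)
    define V' where "V' = V \<inter> {x. u \<bullet> x = 0}"
    have sub: "subspace V'" unfolding V'_def
      by (intro subspace_inter less.prems subspace_hyperplane)
    have inv: "A *v x \<in> V'" if "x \<in> V'" for x
      using that less.prems(2)[of x] symmetric_matrix_inner[OF sym, of u x] u(3)
      by (auto simp: V'_def)
    have "u \<notin> V'" using uu by (simp add: V'_def)
    moreover have "V' \<subseteq> V" by (simp add: V'_def)
    ultimately have "V' \<subset> V" using u(1) by blast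
    then have "dim V' < dim V"
      by (metis dim_psubset less.prems(1) span_eq_iff sub)
    from less.hyps[OF this sub inv] obtain B where
      B: "B \<subseteq> V'" "pairwise orthogonal B" "span B = V'"
        "\<And>x. x \<in> B \<Longrightarrow> norm x = 1 \<and> (\<exists>c. A *v x = c *\<^sub>R x)" by blast
    have "pairwise orthogonal (insert u B)"
      using B(1,2) by (auto simp: pairwise_insert V'_def orthogonal_def inner_commute)
    moreover have "span (insert u B) = V"
    proof
      show "span (insert u B) \<subseteq> V"
        using B(1) u(1) by (intro span_minimal less.prems) (auto simp: V'_def)
      show "V \<subseteq> span (insert u B)"
      proof
        fix x assume "x \<in> V"
        then have "x - (u \<bullet> x) *\<^sub>R u \<in> V'"
          using uu u(1) less.prems(1) by (simp add: V'_def subspace_diff subspace_scale inner_diff_right)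
        then show "x \<in> span (insert u B)" using B(3) by (auto simp: span_breakdown_eq)
      qed
    qed
    moreover have "insert u B \<subseteq> V" using B(1) u(1) by (auto simp: V'_def)
    ultimately show ?thesis using B(4) u(2,3) by (intro exI[of _ "insert u B"]) auto
  qed
qed

theorem symmetric_matrix_diagonalizable:
  fixes A :: "real^'n^'n"
  assumes sym: "transpose A = A"
  obtains P v where "orthogonal_matrix P" "A ** P = P ** diag_matrix v"
proof -
  obtain B where B: "pairwise orthogonal B" "span B = (UNIV :: (real^'n) set)"
      "\<And>u. u \<in> B \<Longrightarrow> norm u = 1" "\<And>u. u \<in> B \<Longrightarrow> \<exists>c. A *v u = c *\<^sub>R u"
    using symmetric_invariant_subspace_eigenbasis[OF sym, of UNIV] by auto
  have "0 \<notin> B" using B(3) by fastforce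
  then have ind: "independent B" using B(1) pairwise_orthogonal_independent by blast
  then have "card B = CARD('n)"
    using dim_eq_card[of B UNIV] B(2) by (simp add: dim_UNIV)
  then obtain q where q: "bij_betw q (UNIV::'n set) B"
    using finite_same_card_bij[OF finite_class.finite_UNIV finiteI_independent[OF ind]] by auto
  have qB: "q i \<in> B" for i using q by (auto simp: bij_betw_def)
  then have "\<forall>i. \<exists>c. A *v q i = c *\<^sub>R q i" using B(4) by blast
  then obtain v where v: "\<And>i. A *v q i = v i *\<^sub>R q i" unfolding choice_iff by blast
  define P :: "real^'n^'n" where "P = (\<chi> i j. q j $ i)"
  have col: "column j P = q j" for j by (simp add: column_def P_def vec_eq_iff)
  have "q i \<noteq> q j" if "i \<noteq> j" for i j using q that by (auto simp: bij_betw_def inj_on_def)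
  then have "orthogonal_matrix P"
    unfolding orthogonal_matrix_orthonormal_columns col
    using B(3) qB B(1) by (auto simp: pairwise_def)
  moreover have "A ** P = P ** diag_matrix v"
  proof -
    have "(A ** P) $ i $ j = (A *v q j) $ i" for i j
      by (simp add: matrix_matrix_mult_def matrix_vector_mult_def P_def)
    then show ?thesis by (simp add: vec_eq_iff matrix_mult_diag_right v P_def)
  qed
  ultimately show thesis by (rule that)
qed

section \<open>Eigenvalues and multiplicities in an orthogonal frame\<close>

lemma orthogonal_matrix_mult_cancel [simp]:
  fixes P :: "real^'n^'n"
  assumes "orthogonal_matrix P"
  shows "transpose P ** (P ** M) = M" "P ** (transpose P ** M) = M"
  using assms by (simp_all add: matrix_mul_assoc orthogonal_matrix_def)

lemma diagonalized_eq:
  fixes A P :: "real^'n^'n"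
  assumes "orthogonal_matrix P" "A ** P = P ** diag_matrix v"
  shows "A = P ** diag_matrix v ** transpose P"
  by (metis assms matrix_mul_assoc matrix_mul_rid orthogonal_matrix_def)

lemma diagonalized_symmetric:
  fixes A P :: "real^'n^'n"
  assumes "orthogonal_matrix P" "A ** P = P ** diag_matrix v"
  shows "transpose A = A"
  by (simp add: diagonalized_eq[OF assms] matrix_transpose_mul matrix_mul_assoc)

text \<open>In the coordinates \<open>z = transpose P *v x\<close> the eigenvector equation reads
  \<open>v a * z $ a = c * z $ a\<close>. With the converse in
  \<open>diagonalized_combination\<close>, an eigenspace becomes a coordinate subspace of the
  frame.\<close>

lemma diagonalized_coordinates:
  fixes A P :: "real^'n^'n"
  assumes P: "orthogonal_matrix P" and v: "A ** P = P ** diag_matrix v"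
    and x: "A *v x = c *\<^sub>R x" and nz: "(transpose P *v x) $ a \<noteq> 0"
  shows "v a = c"
proof -
  have "transpose P ** A = diag_matrix v ** transpose P"
    unfolding diagonalized_eq[OF P v]
    using P by (simp flip: matrix_mul_assoc)
  then have "diag_matrix v *v (transpose P *v x) = c *\<^sub>R (transpose P *v x)"
    by (metis matrix_vector_mul_assoc matrix_vector_mult_scaleR x)
  then have "v a * (transpose P *v x) $ a = c * (transpose P *v x) $ a"
    by (metis diag_matrix_vector vector_scaleR_component real_scaleR_def)
  then show ?thesis using nz by simp
qed

lemma diagonalized_combination:
  fixes A P :: "real^'n^'n"
  assumes v: "A ** P = P ** diag_matrix v" and z: "\<And>a. z $ a \<noteq> 0 \<Longrightarrow> v a = c"
  shows "A *v (P *v z) = c *\<^sub>R (P *v z)"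
proof -
  have "diag_matrix v *v z = c *\<^sub>R z"
    using z by (auto simp: vec_eq_iff diag_matrix_vector)
  then show ?thesis
    by (metis matrix_vector_mul_assoc matrix_vector_mult_scaleR v)
qed

lemma diagonalized_eigenvalues:
  fixes A P :: "real^'n^'n"
  assumes P: "orthogonal_matrix P" and v: "A ** P = P ** diag_matrix v"
  shows "eigenvalues A = range v"
proof
  show "eigenvalues A \<subseteq> range v"
  proof
    fix c assume "c \<in> eigenvalues A"
    then obtain x where x: "x \<noteq> 0" "A *v x = c *\<^sub>R x" by (auto simp: eigenvalues_def)
    have "P *v (transpose P *v x) = x"
      using P by (simp add: matrix_vector_mul_assoc orthogonal_matrix_def del: transpose_matrix_vector)
    then have "transpose P *v x \<noteq> 0" using x(1) by (metis matrix_vector_mult_0_right)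
    then obtain a where "(transpose P *v x) $ a \<noteq> 0" by (metis vec_eq_iff zero_index)
    then show "c \<in> range v" using diagonalized_coordinates[OF P v x(2)] by blast
  qed
  show "range v \<subseteq> eigenvalues A"
  proof safe
    fix a
    have "A *v (P *v axis a 1) = v a *\<^sub>R (P *v axis a 1)"
      by (rule diagonalized_combination[OF v]) (auto simp: axis_def split: if_splits)
    moreover have "P *v axis a 1 \<noteq> 0"
    proof
      assume "P *v axis a 1 = 0"
      then have "transpose P *v (P *v axis a 1) = 0" by (metis matrix_vector_mult_0_right)
      then have "axis a 1 = (0 :: real^'n)"
        using P by (simp add: matrix_vector_mul_assoc orthogonal_matrix_def del: transpose_matrix_vector)
      then show False by (simp add: axis_eq_0_iff)
    qed
    ultimately show "v a \<in> eigenvalues A" by (auto simp: eigenvalues_def)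
  qed
qed

lemma map_matrix_const_poly_mult:
  fixes A B :: "real^'n^'n"
  shows "map_matrix (\<lambda>a. [:a:]) (A ** B) = map_matrix (\<lambda>a. [:a:]) A ** map_matrix (\<lambda>a. [:a:]) B"
proof -
  have "(\<Sum>x\<in>S. [:f x:]) = [:sum f S:]" for f :: "'n \<Rightarrow> real" and S
    by (induction S rule: infinite_finite_induct) simp_all
  then show ?thesis
    by (simp add: vec_eq_iff map_matrix_def matrix_matrix_mult_def mult.commute)
qed

lemma order_prod_linear:
  fixes v :: "'n::finite \<Rightarrow> real"
  shows "finite S \<Longrightarrow> Polynomial.order c (\<Prod>i\<in>S. [:- v i, 1:]) = card {i\<in>S. v i = c}"
proof (induction S rule: finite_induct)
  case (insert x S)
  have nz: "[:- v x, 1:] * (\<Prod>i\<in>S. [:- v i, 1:]) \<noteq> 0"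
    using insert(1) by (simp add: prod_zero_iff del: mult_pCons_left)
  have *: "Polynomial.order c [:- v x, 1:] = (if v x = c then 1 else 0)"
    using order_power_n_n[of "v x" 1] by (auto intro: order_0I)
  have "{i \<in> insert x S. v i = c} = (if v x = c then insert x {i\<in>S. v i = c} else {i\<in>S. v i = c})"
    by auto
  then show ?case using insert * by (simp add: order_mult[OF nz] del: mult_pCons_left)
qed simp

text \<open>The diagonalization is lifted to matrices over the polynomial ring, where the scalar
  matrix of the variable commutes with the frame; hence the characteristic polynomial is the product
  of the factors \<open>[:- v i, 1:]\<close>.\<close>

lemma diagonalized_multiplicity:
  fixes A P :: "real^'n^'n"
  assumes P: "orthogonal_matrix P" and v: "A ** P = P ** diag_matrix v"
  shows "eigenvalue_multiplicity A c = card {a. v a = c}"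
proof -
  let ?m = "map_matrix (\<lambda>a::real. [:a:]) :: real^'n^'n \<Rightarrow> real poly^'n^'n"
  let ?X = "mat [:0, 1:] :: real poly^'n^'n"
  have one: "?m P ** ?m (transpose P) = mat 1"
    using P unfolding map_matrix_const_poly_mult[symmetric] orthogonal_matrix_def
    by (simp add: vec_eq_iff map_matrix_def mat_def one_pCons)
  have comm: "?m P ** ?X = ?X ** ?m P"
    by (simp add: vec_eq_iff matrix_matrix_mult_def mat_def if_distrib if_distribR cong: if_cong)
  have "?X - ?m A = ?m P ** (?X - ?m (diag_matrix v)) ** ?m (transpose P)"
  proof -
    have "?m P ** (?X - ?m (diag_matrix v)) ** ?m (transpose P)
        = ?m P ** ?X ** ?m (transpose P) - ?m P ** ?m (diag_matrix v) ** ?m (transpose P)"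
      by (simp add: vec_eq_iff matrix_matrix_mult_def sum_subtractf sum_distrib_right algebra_simps)
    also have "?m P ** ?X ** ?m (transpose P) = ?X ** (?m P ** ?m (transpose P))"
      by (simp add: comm matrix_mul_assoc)
    also have "\<dots> = ?X" by (simp add: one)
    finally show ?thesis by (simp add: diagonalized_eq[OF P v] map_matrix_const_poly_mult)
  qed
  then have "char_polynomial A = (det (?m P) * det (?m (transpose P))) * det (?X - ?m (diag_matrix v))"
    by (simp add: char_polynomial_def det_mul mult_ac)
  also have "det (?m P) * det (?m (transpose P)) = 1"
    by (metis det_mul det_I one)
  also have "det (?X - ?m (diag_matrix v)) = (\<Prod>i\<in>UNIV. [:- v i, 1:])"
    by (subst det_diagonal) (auto simp: mat_def map_matrix_def)
  finally show ?thesis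
    by (simp add: eigenvalue_multiplicity_def order_prod_linear)
qed

section \<open>Prescribed multiplicities as a pattern of equal diagonal entries\<close>

text \<open>The labelling \<open>b\<close> fixes which columns of the frame share an eigenvalue; the
  eigenvalues themselves stay free. Columns in a fixed order make frames of different matrices
  comparable.\<close>

definition spectral_type :: "('n::finite \<Rightarrow> 'b) \<Rightarrow> (real^'n^'n) set" where
  "spectral_type b = {A. \<exists>P v. orthogonal_matrix P \<and> A ** P = P ** diag_matrix v \<and>
                           (\<forall>i j. v i = v j \<longleftrightarrow> b i = b j)}"

text \<open>Fibres over the same value have equal size, so they are matched by bijections
  \<open>h c\<close>, which glue to a permutation.\<close>

lemma ex_permutation_of_fibres:
  fixes f g :: "'a::finite \<Rightarrow> 'b"
  assumes "\<And>c. card {a. f a = c} = card {a. g a = c}"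
  obtains p where "bij p" "\<And>a. f (p a) = g a"
proof -
  have "\<exists>h. bij_betw h {a. g a = c} {a. f a = c}" for c
    by (intro finite_same_card_bij) (auto simp: assms)
  then obtain h where h: "\<And>c. bij_betw (h c) {a. g a = c} {a. f a = c}" by metis
  define p where "p a = h (g a) a" for a
  have fp: "f (p a) = g a" for a
    using h[of "g a"] by (auto simp: p_def bij_betw_def)
  have "inj p"
  proof (rule injI)
    fix a a' assume eq: "p a = p a'"
    then have "g a = g a'" using fp by metis
    then show "a = a'" using eq h[of "g a"] by (auto simp: p_def bij_betw_def inj_on_def)
  qed
  then have "bij p" by (simp add: finite_UNIV_inj_surj bij_def)
  then show thesis using fp that by blast
qed

text \<open>The spectral theorem gives a frame with the right multiplicities but in an arbitrary
  order; permuting its columns sorts them into the fibres of \<open>b\<close>. Conversely, the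
  common value of \<open>v\<close> on a fibre numbers the eigenvalues.\<close>

lemma symmetric_with_multiplicities_eq_spectral_type:
  fixes b :: "'n::finite \<Rightarrow> nat"
  assumes b: "range b = {1..m}" and k: "\<And>i. i \<in> {1..m} \<Longrightarrow> card {a. b a = i} = k i"
  shows "symmetric_with_multiplicities m k = spectral_type b"
proof (intro equalityI subsetI)
  fix A :: "real^'n^'n" assume "A \<in> symmetric_with_multiplicities m k"
  then obtain \<mu> where sym: "transpose A = A" and \<mu>: "bij_betw \<mu> {1..m} (eigenvalues A)"
      "\<And>i. i \<in> {1..m} \<Longrightarrow> eigenvalue_multiplicity A (\<mu> i) = k i"
    by (auto simp: symmetric_with_multiplicities_def symmetric_matrices_def)
  obtain P v where P: "orthogonal_matrix P" and v: "A ** P = P ** diag_matrix v"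
    using symmetric_matrix_diagonalizable[OF sym] by blast
  have ev: "range v = \<mu> ` {1..m}"
    using \<mu>(1) diagonalized_eigenvalues[OF P v] by (simp add: bij_betw_def)
  have b_in: "b a \<in> {1..m}" for a using b by blast
  have inj: "\<mu> i = \<mu> j \<longleftrightarrow> i = j" if "i \<in> {1..m}" "j \<in> {1..m}" for i j
    using inj_on_eq_iff[OF bij_betw_imp_inj_on[OF \<mu>(1)] that] .
  \<comment> \<open>Both sides are the multiplicity of \<open>c\<close>, or zero if \<open>c\<close>
    is not an eigenvalue; this is what allows \<open>v\<close> to be rearranged into
    \<open>\<mu> \<circ> b\<close>.\<close>
  have "card {a. v a = c} = card {a. \<mu> (b a) = c}" for c
  proof (cases "c \<in> \<mu> ` {1..m}")
    case True
    then obtain i where i: "i \<in> {1..m}" "c = \<mu> i" by blast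
    have "{a. \<mu> (b a) = c} = {a. b a = i}" using inj[OF b_in i(1)] i(2) by blast
    then show ?thesis using \<mu>(2)[OF i(1)] k[OF i(1)] diagonalized_multiplicity[OF P v] i by simp
  next
    case False
    then have "{a. v a = c} = {}" "{a. \<mu> (b a) = c} = {}" using ev b_in by blast+
    then show ?thesis by simp
  qed
  then obtain p where p: "bij p" "\<And>a. v (p a) = \<mu> (b a)"
    using ex_permutation_of_fibres[of v "\<lambda>a. \<mu> (b a)"] by metis
  define Q :: "real^'n^'n" where "Q = (\<chi> i j. P $ i $ p j)"
  have col: "column j Q = column (p j) P" for j by (simp add: column_def Q_def)
  have "p i = p j \<longleftrightarrow> i = j" for i j using p(1) by (simp add: bij_def inj_eq)
  then have "orthogonal_matrix Q"
    using P unfolding orthogonal_matrix_orthonormal_columns col by simp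
  moreover have "A ** Q = Q ** diag_matrix (v \<circ> p)"
  proof -
    have "(A ** Q) $ i $ j = (A ** P) $ i $ p j" for i j
      by (simp add: matrix_matrix_mult_def Q_def)
    then show ?thesis
      by (simp add: v vec_eq_iff matrix_mult_diag_right) (simp add: Q_def)
  qed
  moreover have "(v \<circ> p) i = (v \<circ> p) j \<longleftrightarrow> b i = b j" for i j
    using inj[OF b_in b_in] by (simp add: p(2))
  ultimately show "A \<in> spectral_type b" unfolding spectral_type_def by blast
next
  fix A :: "real^'n^'n" assume "A \<in> spectral_type b"
  then obtain P v where P: "orthogonal_matrix P" and v: "A ** P = P ** diag_matrix v"
    and vb: "\<And>i j. v i = v j \<longleftrightarrow> b i = b j" unfolding spectral_type_def by blast
  define \<mu> where "\<mu> i = v (inv_into UNIV b i)" for i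
  have \<mu>b: "\<mu> (b a) = v a" for a
    unfolding \<mu>_def using vb[of "inv_into UNIV b (b a)" a] f_inv_into_f[of "b a" b UNIV] by simp
  have "inj_on \<mu> {1..m}" unfolding b[symmetric] by (auto simp: inj_on_def \<mu>b vb)
  moreover have "\<mu> ` {1..m} = eigenvalues A"
    unfolding b[symmetric] diagonalized_eigenvalues[OF P v] by (simp add: image_image \<mu>b)
  moreover have "eigenvalue_multiplicity A (\<mu> i) = k i" if "i \<in> {1..m}" for i
  proof -
    obtain a where a: "i = b a" using b \<open>i \<in> {1..m}\<close> by blast
    show ?thesis
      using k[OF that] unfolding a \<mu>b diagonalized_multiplicity[OF P v] vb .
  qed
  ultimately show "A \<in> symmetric_with_multiplicities m k"
    using diagonalized_symmetric[OF P v]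
    by (auto simp: symmetric_with_multiplicities_def symmetric_matrices_def bij_betw_def)
qed

section \<open>Dimension of subsets of Euclidean spaces\<close>

text \<open>No manifold structure on \<open>S\<close> is assumed: one copy of the model space inside
  \<open>S\<close> bounds the dimension from below, and local continuous injections into a space of
  dimension \<open>d\<close> bound it from above by invariance of domain.\<close>

lemma real_dim_eqI:
  fixes S :: "'a::euclidean_space set" and W :: "'b::euclidean_space set"
  assumes T: "T \<subseteq> S" "top_of_set T homeomorphic_space Euclidean_space d"
    and W: "subspace W" "dim W = d"
    and inj: "\<And>x. x \<in> S \<Longrightarrow> \<exists>U f. openin (top_of_set S) U \<and> x \<in> U \<and>
                 continuous_on U f \<and> f ` U \<subseteq> W \<and> inj_on f U"
  shows "real_dim S = d"
proof -
  let ?D = "{d. \<exists>T\<subseteq>S. top_of_set T homeomorphic_space Euclidean_space d}"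
  obtain w where "homeomorphic_map (top_of_set W) (Euclidean_space d) w"
    using homeomorphic_subspace_Euclidean_space[OF W(1)] W(2) homeomorphic_space by blast
  then have w: "continuous_map (top_of_set W) (Euclidean_space d) w" "inj_on w W"
    by (auto simp: homeomorphic_eq_everything_map)
  have le: "e \<le> d" if "e \<in> ?D" for e
  proof -
    obtain T where T: "T \<subseteq> S" "top_of_set T homeomorphic_space Euclidean_space e"
      using \<open>e \<in> ?D\<close> by auto
    obtain h where "homeomorphic_map (Euclidean_space e) (top_of_set T) h"
      using T(2) homeomorphic_space homeomorphic_space_sym by blast
    then have h: "continuous_map (Euclidean_space e) (top_of_set T) h"
      "inj_on h (topspace (Euclidean_space e))" "h ` topspace (Euclidean_space e) = T"
      by (auto simp: homeomorphic_eq_everything_map)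
    obtain z where z: "z \<in> topspace (Euclidean_space e)"
      using nontrivial_Euclidean_space by fastforce
    then have "h z \<in> S" using h(3) T(1) by auto
    then obtain U f where U: "openin (top_of_set S) U" "h z \<in> U"
      and f: "continuous_on U f" "f ` U \<subseteq> W" "inj_on f U"
      using inj by blast
    define V where "V = {x \<in> topspace (Euclidean_space e). h x \<in> U}"
    have hS: "continuous_map (Euclidean_space e) (top_of_set S) h"
      using h(1) T(1) by (auto simp: continuous_map_in_subtopology)
    have "openin (Euclidean_space e) V"
      unfolding V_def by (rule openin_continuous_map_preimage[OF hS U(1)])
    moreover have "V \<noteq> {}" using z U(2) by (auto simp: V_def)
    moreover have hV: "continuous_map (subtopology (Euclidean_space e) V) (top_of_set U) h"
      using continuous_map_from_subtopology[OF h(1), of V]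
      by (auto simp: continuous_map_in_subtopology V_def)
    moreover have fW: "continuous_map (top_of_set U) (top_of_set W) f"
      using f by (simp add: continuous_map_subtopology_eu image_subset_iff_funcset)
    ultimately have V: "openin (Euclidean_space e) V" "V \<noteq> {}"
      "continuous_map (subtopology (Euclidean_space e) V) (Euclidean_space d) (w \<circ> (f \<circ> h))"
      using continuous_map_compose[OF continuous_map_compose[OF hV fW] w(1)] by simp_all
    have "inj_on (w \<circ> (f \<circ> h)) V"
    proof (intro comp_inj_on)
      show "inj_on h V" using h(2) by (auto simp: inj_on_def V_def)
      show "inj_on f (h ` V)" using f(3) by (rule inj_on_subset) (auto simp: V_def)
      show "inj_on w ((f \<circ> h) ` V)" using w(2) by (rule inj_on_subset) (use f(2) in \<open>auto simp: V_def\<close>)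
    qed
    then show ?thesis by (rule Euclidean_space_injection_le[OF V])
  qed
  moreover have "d \<in> ?D" using T by blast
  moreover have "finite ?D"
    unfolding finite_nat_set_iff_bounded_le using le by blast
  ultimately show ?thesis
    unfolding real_dim_def by (intro Max_eqI)
qed

lemma subspace_Int_ball_homeomorphic:
  fixes W :: "'a::euclidean_space set"
  assumes W: "subspace W" and r: "r > 0"
  shows "W homeomorphic (W \<inter> ball 0 r)"
proof -
  \<comment> \<open>Radial compression and its inverse; both preserve every line through the origin
    and hence the subspace \<open>W\<close>.\<close>
  let ?f = "\<lambda>x::'a. (r / (1 + norm x)) *\<^sub>R x" and ?g = "\<lambda>y::'a. (1 / (r - norm y)) *\<^sub>R y"
  have pos: "1 + norm x > 0" for x :: 'a by (simp add: add_pos_nonneg)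
  have n: "norm (?f x) = r * norm x / (1 + norm x)" for x
    using r pos[of x] by simp
  have lt: "norm (?f x) < r" for x
    unfolding n using r pos[of x] by (simp add: field_simps)
  have rn: "r - norm (?f x) = r / (1 + norm x)" for x
    unfolding n using pos[of x] by (simp add: field_simps)
  have gf: "?g (?f x) = x" for x
    unfolding rn using r pos[of x] by simp
  have fg: "?f (?g y) = y" if "y \<in> W \<inter> ball 0 r" for y
  proof -
    have y: "norm y < r" using that by simp
    then have "1 + norm (?g y) = r / (r - norm y)" by (simp add: field_simps)
    then show ?thesis using y r by simp
  qed
  have im: "?f ` W = W \<inter> ball 0 r"
  proof
    show "?f ` W \<subseteq> W \<inter> ball 0 r" using lt W by (auto simp: subspace_scale)
    show "W \<inter> ball 0 r \<subseteq> ?f ` W"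
    proof
      fix y assume y: "y \<in> W \<inter> ball 0 r"
      then have "?g y \<in> W" using W by (auto simp: subspace_scale)
      then show "y \<in> ?f ` W" by (rule image_eqI[of y ?f "?g y" W, OF fg[OF y, symmetric]])
    qed
  qed
  have im': "?g ` (W \<inter> ball 0 r) = W"
    unfolding im[symmetric] image_image gf by simp
  have cf: "continuous_on W ?f" using pos by (intro continuous_intros) (metis less_irrefl)
  have cg: "continuous_on (W \<inter> ball 0 r) ?g" by (intro continuous_intros) auto
  show ?thesis
    by (rule homeomorphicI[of ?f W "W \<inter> ball 0 r" ?g]) (rule im im' cf cg gf fg; assumption)+
qed

text \<open>On the compact closed ball a continuous injection is automatically a homeomorphism onto
  its image; this is then restricted to the open ball.\<close>

lemma injective_image_ball_homeomorphic_Euclidean_space: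
  fixes W :: "'a::euclidean_space set" and F :: "'a \<Rightarrow> 'b::t2_space"
  assumes W: "subspace W" and r: "r > 0"
    and F: "continuous_on (W \<inter> cball 0 r) F" "inj_on F (W \<inter> cball 0 r)"
  shows "top_of_set (F ` (W \<inter> ball 0 r)) homeomorphic_space Euclidean_space (dim W)"
proof -
  have "compact (W \<inter> cball 0 r)" using W by (simp add: closed_subspace closed_Int_compact)
  then obtain g where "homeomorphism (W \<inter> cball 0 r) (F ` (W \<inter> cball 0 r)) F g"
    using homeomorphism_compact[OF _ F(1) refl F(2)] by blast
  then have "homeomorphism (W \<inter> ball 0 r) (F ` (W \<inter> ball 0 r)) F g"
    by (rule homeomorphism_of_subsets) auto
  then have "F ` (W \<inter> ball 0 r) homeomorphic W"
    using subspace_Int_ball_homeomorphic[OF W r] homeomorphic_sym homeomorphic_trans homeomorphic_def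
    by metis
  then have "top_of_set (F ` (W \<inter> ball 0 r)) homeomorphic_space top_of_set W"
    by (metis homeomorphic_maps_iff_homeomorphism homeomorphic_def homeomorphic_space_def)
  then show ?thesis
    using homeomorphic_subspace_Euclidean_space_dim[OF W] homeomorphic_space_trans by blast
qed

section \<open>Matrices with prescribed support\<close>

text \<open>These coordinate subspaces are the parameter space of the chart in the lower bound and
  the target of the local injections in the upper bound.\<close>

definition supported_matrices :: "('n \<times> 'n) set \<Rightarrow> (real^'n^'n) set" where
  "supported_matrices J = {M. \<forall>i j. (i, j) \<notin> J \<longrightarrow> M $ i $ j = 0}"

lemma subspace_supported_matrices: "subspace (supported_matrices J)"
  by (auto simp: subspace_def supported_matrices_def)

lemma dim_supported_matrices: "dim (supported_matrices J :: (real^'n^'n) set) = card J"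
proof -
  let ?e = "\<lambda>(i, j). axis i (axis j 1) :: real^'n^'n"
  have e_eq: "?e p = ?e q \<longleftrightarrow> p = q" for p q
    by (auto simp: axis_eq_axis split: prod.splits)
  have e_inner: "M \<bullet> axis i (axis j 1) = M $ i $ j" for M :: "real^'n^'n" and i j
    by (simp add: inner_axis)
  have e_mem: "axis i (axis j 1) \<in> ?e ` J \<longleftrightarrow> (i, j) \<in> J" for i j
    using e_eq[of "(i, j)"] by (auto simp: image_iff)
  have Basis: "(Basis :: (real^'n^'n) set) = range ?e"
    by (auto simp: Basis_vec_def image_iff)
  have "supported_matrices J = {M. \<forall>x\<in>Basis. x \<notin> ?e ` J \<longrightarrow> M \<bullet> x = 0}"
    unfolding Basis supported_matrices_def
    using e_mem by (auto simp: e_inner)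
  moreover have "?e ` J \<subseteq> Basis" unfolding Basis by blast
  moreover have "card (?e ` J) = card J" by (intro card_image injI inj_onI) (simp only: e_eq)
  ultimately show ?thesis by (simp only: dim_substandard)
qed

lemma card_off_diagonal_pairs:
  fixes b :: "'n::finite \<Rightarrow> nat"
  shows "2 * card {(i, j). b i < b j} + card {(i, j). b i = b j} = CARD('n)\<^sup>2"
proof -
  have "card {(i, j). b i < b j} = card {(i, j). b j < b i}"
    by (rule bij_betw_same_card[of "\<lambda>(i, j). (j, i)"])
       (auto simp: bij_betw_def inj_on_def image_iff)
  moreover have "{(i, j). b i < b j} \<union> {(i, j). b j < b i} \<union> {(i, j). b i = b j} = UNIV"
    by auto
  moreover have "card ({(i, j). b i < b j} \<union> {(i, j). b j < b i} \<union> {(i, j). b i = b j})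
      = card {(i, j). b i < b j} + card {(i, j). b j < b i} + card {(i, j). b i = b j}"
    by (subst card_Un_disjoint; (subst card_Un_disjoint)?) auto
  ultimately show ?thesis by (simp add: power2_eq_square card_cartesian_product flip: UNIV_Times_UNIV)
qed

text \<open>For an auxiliary order of the indices, \<open>M + transpose M\<close> identifies the
  matrices supported on and above the diagonal with the symmetric ones.\<close>

lemma dim_symmetric_matrices:
  "2 * dim (symmetric_matrices :: (real^'n^'n) set) = CARD('n) * (CARD('n) + 1)"
proof -
  obtain b :: "'n \<Rightarrow> nat" where b: "inj b" using finite_imp_inj_to_nat_seg[of "UNIV::'n set"] by auto
  define J where "J = {(i, j). b i < b j} \<union> {(i, j). b i = b j}"
  let ?f = "\<lambda>M::real^'n^'n. M + transpose M"
  have diag: "{(i, j). b i = b j} = (\<lambda>i. (i, i)) ` UNIV" using b by (auto simp: inj_eq)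
  have cd: "card {(i, j). b i = b j} = CARD('n)" unfolding diag by (rule card_image) (simp add: inj_on_def)
  have "card J = card {(i, j). b i < b j} + CARD('n)"
    unfolding J_def by (subst card_Un_disjoint) (auto simp: cd)
  then have "2 * card J = CARD('n) * (CARD('n) + 1)"
    using card_off_diagonal_pairs[of b] cd by (simp add: power2_eq_square algebra_simps)
  moreover have lin: "linear ?f"
    by (auto intro!: linearI simp: transpose_def vec_eq_iff algebra_simps)
  have "inj_on ?f (supported_matrices J)"
  proof (rule inj_onI)
    fix M N :: "real^'n^'n"
    assume M: "M \<in> supported_matrices J" and N: "N \<in> supported_matrices J" and eq: "?f M = ?f N"
    have "M $ i $ j = N $ i $ j" for i j
    proof -
      have e: "M $ i $ j + M $ j $ i = N $ i $ j + N $ j $ i"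
        using eq by (simp add: vec_eq_iff transpose_def)
      consider "i = j" | "(i, j) \<notin> J" | "(j, i) \<notin> J" using b by (force simp: J_def inj_eq)
      then show ?thesis using e M N by cases (auto simp: supported_matrices_def)
    qed
    then show "M = N" by (simp add: vec_eq_iff)
  qed
  then have "dim (?f ` supported_matrices J) = card J"
    using dim_image_eq[OF lin, of "supported_matrices J"] span_eq_iff subspace_supported_matrices
      dim_supported_matrices by metis
  moreover have "?f ` supported_matrices J = symmetric_matrices"
  proof
    show "?f ` supported_matrices J \<subseteq> symmetric_matrices"
      by (auto simp: symmetric_matrices_def transpose_def vec_eq_iff)
    show "symmetric_matrices \<subseteq> ?f ` supported_matrices J"
    proof
      fix A :: "real^'n^'n" assume "A \<in> symmetric_matrices"
      then have A: "A $ j $ i = A $ i $ j" for i j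
        by (simp add: symmetric_matrices_def transpose_def vec_eq_iff)
      \<comment> \<open>The diagonal is halved because \<open>?f\<close> doubles it.\<close>
      define M :: "real^'n^'n" where
        "M = (\<chi> i j. if b i < b j then A $ i $ j else if b i = b j then A $ i $ j / 2 else 0)"
      have "M $ i $ j + M $ j $ i = A $ i $ j" for i j
        using A[of i j] by (auto simp: M_def)
      then have "A = ?f M" by (simp add: vec_eq_iff transpose_def)
      moreover have "M \<in> supported_matrices J" by (auto simp: supported_matrices_def M_def J_def)
      ultimately show "A \<in> ?f ` supported_matrices J" by blast
    qed
  qed
  ultimately show ?thesis by metis
qed

section \<open>Local injectivity of the chart entries\<close>

lemma diagonalized_column:
  fixes A P :: "real^'n^'n"
  assumes "A ** P = P ** diag_matrix v"
  shows "A *v column j P = v j *\<^sub>R column j P"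
  unfolding matrix_vector_mult_basis[symmetric]
  by (rule diagonalized_combination[OF assms]) (auto simp: axis_def split: if_splits)

lemma conjugated_entry:
  fixes P M :: "real^'n^'n"
  shows "(transpose P ** M ** P) $ i $ j = column i P \<bullet> (M *v column j P)"
proof -
  have "X $ i $ j = axis i 1 \<bullet> (X *v axis j 1)" for X :: "real^'n^'n"
    by (simp add: matrix_vector_mult_basis inner_axis' column_def)
  then have "(transpose P ** M ** P) $ i $ j = axis i 1 \<bullet> (transpose P *v (M *v (P *v axis j 1)))"
    by (simp only: matrix_vector_mul_assoc matrix_mul_assoc)
  also have "\<dots> = (P *v axis i 1) \<bullet> (M *v (P *v axis j 1))"
    by (metis dot_lmul_matrix vector_transpose_matrix)
  finally show ?thesis by (simp add: matrix_vector_mult_basis)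
qed

lemma diagonalized_value:
  fixes A P :: "real^'n^'n"
  assumes "orthogonal_matrix P" "A ** P = P ** diag_matrix v"
  shows "transpose P ** A ** P = diag_matrix v"
  using assms by (simp flip: matrix_mul_assoc)

text \<open>Membership in \<open>spectral_type b\<close> forces as many distinct eigenvalues as
  there are fibres. If \<open>v\<close> is constant on fibres, it induces a surjection from fibres
  to eigenvalues between finite sets of equal size, hence a bijection.\<close>

lemma spectral_type_eigenvalues:
  fixes A P :: "real^'n^'n"
  assumes A: "A \<in> spectral_type b" and P: "orthogonal_matrix P" "A ** P = P ** diag_matrix v"
    and b: "\<And>i j. b i = b j \<Longrightarrow> v i = v j"
  shows "v i = v j \<longleftrightarrow> b i = b j"
proof -
  have factor: "range w = (\<lambda>c. w (inv_into UNIV b c)) ` range b \<and> (\<forall>i. w (inv_into UNIV b (b i)) = w i)"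
    if "\<And>i j. b i = b j \<Longrightarrow> w i = w j" for w :: "'n \<Rightarrow> real"
  proof -
    have "w (inv_into UNIV b (b i)) = w i" for i by (rule that) (simp add: f_inv_into_f)
    then show ?thesis by (simp add: image_image)
  qed
  obtain Q w where Q: "orthogonal_matrix Q" "A ** Q = Q ** diag_matrix w"
    and w: "\<And>i j. w i = w j \<longleftrightarrow> b i = b j" using A unfolding spectral_type_def by blast
  have rw: "range w = (\<lambda>c. w (inv_into UNIV b c)) ` range b" "\<And>i. w (inv_into UNIV b (b i)) = w i"
    using factor[of w] w by blast+
  have rv: "range v = (\<lambda>c. v (inv_into UNIV b c)) ` range b" "\<And>i. v (inv_into UNIV b (b i)) = v i"
    using factor[of v] b by blast+
  have "card (range v) = card (range w)"
    using diagonalized_eigenvalues[OF P] diagonalized_eigenvalues[OF Q] by simp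
  also have "\<dots> = card (range b)"
    unfolding rw(1) by (intro card_image inj_onI) (auto simp: w f_inv_into_f)
  finally have inj: "inj_on (\<lambda>c. v (inv_into UNIV b c)) (range b)"
    unfolding rv(1) by (intro eq_card_imp_inj_on) auto
  show ?thesis using inj_on_eq_iff[OF inj, of "b i" "b j"] by (simp add: rv(2))
qed

section \<open>Limits of frames, eigenvectors and secants\<close>

text \<open>Conjugates by the frames stay diagonal in the limit, and equal entries stay equal.
  Different fibres cannot merge, since \<open>A0\<close> has the full number of eigenvalues.\<close>

lemma spectral_type_frame_limit:
  fixes A :: "nat \<Rightarrow> real^'n^'n"
  assumes P: "\<And>n. orthogonal_matrix (P n)" "\<And>n. A n ** P n = P n ** diag_matrix (v n)"
    and v: "\<And>n i j. v n i = v n j \<longleftrightarrow> b i = b j"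
    and A0: "A \<longlonglongrightarrow> A0" "A0 \<in> spectral_type b" and P0: "P \<longlonglongrightarrow> P0"
  obtains v0 where "orthogonal_matrix P0" "A0 ** P0 = P0 ** diag_matrix v0"
    "\<And>i j. v0 i = v0 j \<longleftrightarrow> b i = b j"
proof -
  have orth: "orthogonal_matrix P0"
    using closed_sequentially[OF compact_imp_closed[OF compact_orthogonal_matrices], of P P0] P(1) P0
    by simp
  let ?M = "transpose P0 ** A0 ** P0"
  define v0 where "v0 i = ?M $ i $ i" for i
  have "(\<lambda>n. transpose (P n) ** A n ** P n) \<longlonglongrightarrow> ?M" by (intro tendsto_intros A0 P0)
  then have "(\<lambda>n. diag_matrix (v n) :: real^'n^'n) \<longlonglongrightarrow> ?M" using diagonalized_value[OF P] by simp
  then have lim: "(\<lambda>n. (diag_matrix (v n) :: real^'n^'n) $ i $ j) \<longlonglongrightarrow> ?M $ i $ j" for i j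
    by (intro tendsto_vec_nth)
  have "?M $ i $ j = 0" if "i \<noteq> j" for i j
    using lim[of i j] that by (simp add: LIMSEQ_const_iff)
  then have "?M = diag_matrix v0" by (auto simp: vec_eq_iff v0_def)
  then have eq: "A0 ** P0 = P0 ** diag_matrix v0"
    using orth by (metis matrix_mul_assoc orthogonal_matrix_mult_cancel(2))
  have "(\<lambda>n. v n i) \<longlonglongrightarrow> v0 i" for i using lim[of i i] by (simp add: v0_def)
  moreover have "(\<lambda>n. v n i) = (\<lambda>n. v n j)" if "b i = b j" for i j
    by (rule ext) (simp add: v that)
  ultimately have "v0 i = v0 j" if "b i = b j" for i j
    using that LIMSEQ_unique by metis
  then show thesis using that[OF orth eq] spectral_type_eigenvalues[OF A0(2) orth eq] by blast
qed

text \<open>The coordinates of \<open>x\<close> in the limit frame are reused in the frame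
  \<open>P n\<close>. They are supported on one fibre of \<open>b\<close>, so the same
  \<open>l n\<close> serves the whole eigenspace.\<close>

lemma spectral_type_eigenvector_limit:
  fixes A :: "nat \<Rightarrow> real^'n^'n"
  assumes P: "\<And>n. orthogonal_matrix (P n)" "\<And>n. A n ** P n = P n ** diag_matrix (v n)"
    and v: "\<And>n i j. v n i = v n j \<longleftrightarrow> b i = b j"
    and A0: "A \<longlonglongrightarrow> A0" "A0 \<in> spectral_type b" and P0: "P \<longlonglongrightarrow> P0"
  shows "\<exists>l X. \<forall>x. A0 *v x = c *\<^sub>R x \<longrightarrow>
           (\<forall>n. A n *v X n x = l n *\<^sub>R X n x) \<and> (\<lambda>n. X n x) \<longlonglongrightarrow> x"
proof -
  obtain v0 where orth: "orthogonal_matrix P0" and eq: "A0 ** P0 = P0 ** diag_matrix v0"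
    and v0: "\<And>i j. v0 i = v0 j \<longleftrightarrow> b i = b j"
    using spectral_type_frame_limit[OF P v A0 P0] by blast
  \<comment> \<open>If \<open>c\<close> is not an eigenvalue of \<open>A0\<close> the choice is
    arbitrary; then only \<open>x = 0\<close> satisfies the premise, and its coordinates
    vanish.\<close>
  define l where "l n = v n (SOME i. v0 i = c)" for n
  have "A n *v (P n *v (transpose P0 *v x)) = l n *\<^sub>R (P n *v (transpose P0 *v x))"
    if x: "A0 *v x = c *\<^sub>R x" for n x
  proof (rule diagonalized_combination[OF P(2)])
    fix i assume "(transpose P0 *v x) $ i \<noteq> 0"
    then have i: "v0 i = c" by (rule diagonalized_coordinates[OF orth eq x])
    then have "v0 (SOME i. v0 i = c) = c" by (rule someI)
    then show "v n i = l n" using i v v0 by (metis l_def)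
  qed
  moreover have "(\<lambda>n. P n *v (transpose P0 *v x)) \<longlonglongrightarrow> x" for x
  proof -
    have "P0 *v (transpose P0 *v x) = x"
      using orth by (simp add: matrix_vector_mul_assoc orthogonal_matrix_def del: transpose_matrix_vector)
    moreover have "(\<lambda>n. P n *v (transpose P0 *v x)) \<longlonglongrightarrow> P0 *v (transpose P0 *v x)"
      by (intro tendsto_intros P0)
    ultimately show ?thesis by simp
  qed
  ultimately show ?thesis by (intro exI[of _ l] exI[of _ "\<lambda>n x. P n *v (transpose P0 *v x)"]) blast
qed

text \<open>Along the approximating eigenvectors, \<open>H n\<close> acts as the scalar
  \<open>(l n - m n) / t n\<close>. Convergence of this quotient is not known beforehand, so it is
  eliminated by comparison with a fixed eigenvector \<open>u\<close>, which makes the Rayleigh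
  quotient of \<open>H0\<close> at \<open>u\<close> the scalar \<open>h\<close>.\<close>

lemma spectral_type_secant_limit:
  fixes A B H :: "nat \<Rightarrow> real^'n^'n"
  assumes P: "\<And>n. orthogonal_matrix (P n)" "\<And>n. A n ** P n = P n ** diag_matrix (v n)"
      "\<And>n i j. v n i = v n j \<longleftrightarrow> b i = b j"
    and Q: "\<And>n. orthogonal_matrix (Q n)" "\<And>n. B n ** Q n = Q n ** diag_matrix (w n)"
      "\<And>n i j. w n i = w n j \<longleftrightarrow> b i = b j"
    and A0: "A0 \<in> spectral_type b" "A \<longlonglongrightarrow> A0" "B \<longlonglongrightarrow> A0" and P0: "P \<longlonglongrightarrow> P0" and Q0: "Q \<longlonglongrightarrow> Q0"
    and t: "\<And>n. t n \<noteq> 0" and H: "\<And>n. A n - B n = t n *\<^sub>R H n" "H \<longlonglongrightarrow> H0"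
  shows "\<exists>h. \<forall>x y. A0 *v x = c *\<^sub>R x \<longrightarrow> A0 *v y = c *\<^sub>R y \<longrightarrow> x \<bullet> (H0 *v y) = h * (x \<bullet> y)"
proof -
  obtain l X where X: "\<And>n x. A0 *v x = c *\<^sub>R x \<Longrightarrow> A n *v X n x = l n *\<^sub>R X n x"
    "\<And>x. A0 *v x = c *\<^sub>R x \<Longrightarrow> (\<lambda>n. X n x) \<longlonglongrightarrow> x"
    using spectral_type_eigenvector_limit[OF P A0(2,1) P0, of c] by auto
  obtain m Y where Y: "\<And>n x. A0 *v x = c *\<^sub>R x \<Longrightarrow> B n *v Y n x = m n *\<^sub>R Y n x"
    "\<And>x. A0 *v x = c *\<^sub>R x \<Longrightarrow> (\<lambda>n. Y n x) \<longlonglongrightarrow> x"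
    using spectral_type_eigenvector_limit[OF Q A0(3,1) Q0, of c] by auto
  have secant: "t n * (X n x \<bullet> (H n *v Y n y)) = (l n - m n) * (X n x \<bullet> Y n y)"
    if "A0 *v x = c *\<^sub>R x" "A0 *v y = c *\<^sub>R y" for n x y
  proof -
    have "t n * (X n x \<bullet> (H n *v Y n y)) = X n x \<bullet> ((t n *\<^sub>R H n) *v Y n y)"
      by (simp add: scaleR_matrix_vector_assoc[symmetric])
    also have "\<dots> = X n x \<bullet> (A n *v Y n y) - X n x \<bullet> (B n *v Y n y)"
      unfolding H(1)[symmetric] by (simp add: matrix_vector_mult_diff_rdistrib inner_diff_right)
    also have "X n x \<bullet> (A n *v Y n y) = l n * (X n x \<bullet> Y n y)"
      using symmetric_matrix_inner[OF diagonalized_symmetric[OF P(1,2)]] X(1) that(1) by simp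
    also have "X n x \<bullet> (B n *v Y n y) = m n * (X n x \<bullet> Y n y)" using Y(1) that(2) by simp
    finally show ?thesis by (simp add: algebra_simps)
  qed
  show ?thesis
  proof (cases "\<exists>u. u \<noteq> 0 \<and> A0 *v u = c *\<^sub>R u")
    case True
    then obtain u where u: "u \<noteq> 0" "A0 *v u = c *\<^sub>R u" by blast
    have "x \<bullet> (H0 *v y) = (u \<bullet> (H0 *v u)) / (u \<bullet> u) * (x \<bullet> y)"
      if x: "A0 *v x = c *\<^sub>R x" and y: "A0 *v y = c *\<^sub>R y" for x y
    proof -
      \<comment> \<open>Cross-multiplying the secant identities for \<open>(x, y)\<close> and
        \<open>(u, u)\<close> removes the unknown factor \<open>l n - m n\<close>.\<close>
      have "(X n x \<bullet> (H n *v Y n y)) * (X n u \<bullet> Y n u) = (X n u \<bullet> (H n *v Y n u)) * (X n x \<bullet> Y n y)" for n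
      proof -
        have "t n * ((X n x \<bullet> (H n *v Y n y)) * (X n u \<bullet> Y n u))
            = t n * ((X n u \<bullet> (H n *v Y n u)) * (X n x \<bullet> Y n y))"
          unfolding mult.assoc[symmetric] secant[OF x y] secant[OF u(2) u(2)] by (simp add: mult_ac)
        then show ?thesis using t by simp
      qed
      moreover have "(\<lambda>n. (X n x \<bullet> (H n *v Y n y)) * (X n u \<bullet> Y n u))
          \<longlonglongrightarrow> (x \<bullet> (H0 *v y)) * (u \<bullet> u)"
        by (intro tendsto_intros H X Y x y u)
      moreover have "(\<lambda>n. (X n u \<bullet> (H n *v Y n u)) * (X n x \<bullet> Y n y))
          \<longlonglongrightarrow> (u \<bullet> (H0 *v u)) * (x \<bullet> y)"
        by (intro tendsto_intros H X Y x y u)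
      ultimately have "(x \<bullet> (H0 *v y)) * (u \<bullet> u) = (u \<bullet> (H0 *v u)) * (x \<bullet> y)"
        using LIMSEQ_unique by simp
      then show ?thesis using u(1) by (simp add: field_simps)
    qed
    then show ?thesis by blast
  next
    case False
    then have "x \<bullet> (H0 *v y) = 0 * (x \<bullet> y)" if "A0 *v x = c *\<^sub>R x" for x y
      using that by (metis inner_zero_left mult_zero_left)
    then show ?thesis by blast
  qed
qed

text \<open>Of two transposed positions in different fibres the order of the labels picks one;
  \<open>inv_into\<close> picks one representative index per fibre.\<close>

definition chart_entries :: "('n::finite \<Rightarrow> nat) \<Rightarrow> ('n \<times> 'n) set" where
  "chart_entries b = {(i, j). b i < b j \<or> i = j \<and> inv_into UNIV b (b i) = i}"

text \<open>The entry at a fibre's representative kills the scalar of its block, and symmetry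
  carries the zeros above the blocks to those below.\<close>

lemma chart_entries_kernel:
  fixes E :: "real^'n^'n"
  assumes sym: "\<And>i j. E $ j $ i = E $ i $ j"
    and block: "\<And>i j. b i = b j \<Longrightarrow> E $ i $ j = h (b i) * (if i = j then 1 else 0)"
    and zero: "\<And>i j. (i, j) \<in> chart_entries b \<Longrightarrow> E $ i $ j = 0"
  shows "E = 0"
proof -
  have "E $ i $ j = 0" for i j
  proof (cases "b i = b j")
    case True
    let ?r = "inv_into UNIV b (b i)"
    have br: "b ?r = b i" by (simp add: f_inv_into_f)
    then have "E $ ?r $ ?r = 0" by (intro zero) (simp add: chart_entries_def)
    then have "h (b i) = 0" using block[of ?r ?r] br by simp
    then show ?thesis using block[OF True] by simp
  next
    case False
    then have "b i < b j \<or> b j < b i" by auto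
    then show ?thesis using zero[of i j] zero[of j i] sym[of i j] by (auto simp: chart_entries_def)
  qed
  then show ?thesis by (simp add: vec_eq_iff)
qed

lemma not_locally_injective_sequences:
  fixes a :: "'a::metric_space"
  assumes not_inj: "\<not> (\<exists>e>0. inj_on f (S \<inter> ball a e))"
  obtains A B where "\<And>n. A n \<in> S" "\<And>n. B n \<in> S" "\<And>n. A n \<noteq> B n" "\<And>n. f (A n) = f (B n)"
    "A \<longlonglongrightarrow> a" "B \<longlonglongrightarrow> a"
proof -
  have "\<exists>p. fst p \<in> S \<and> snd p \<in> S \<and>
          dist a (fst p) < inverse (real (Suc n)) \<and> dist a (snd p) < inverse (real (Suc n)) \<and>
          fst p \<noteq> snd p \<and> f (fst p) = f (snd p)" (is "\<exists>p. ?Q n p") for n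
  proof (rule ccontr)
    assume neg: "\<not> ?thesis"
    have "inj_on f (S \<inter> ball a (inverse (real (Suc n))))"
    proof (rule inj_onI, rule ccontr)
      fix A B
      assume "A \<in> S \<inter> ball a (inverse (real (Suc n)))"
        "B \<in> S \<inter> ball a (inverse (real (Suc n)))" "f A = f B" "A \<noteq> B"
      then have "?Q n (A, B)" by simp
      then show False using neg by blast
    qed
    moreover have "0 < inverse (real (Suc n))" by simp
    ultimately show False using not_inj by blast
  qed
  then obtain p where p: "\<And>n. ?Q n (p n)" by metis
  have lim: "X \<longlonglongrightarrow> a" if X: "\<And>n. dist a (X n) < inverse (real (Suc n))" for X
  proof (rule tendstoI)
    fix e :: real assume "0 < e"
    with LIMSEQ_inverse_real_of_nat have "\<forall>\<^sub>F n in sequentially. inverse (real (Suc n)) < e"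
      by (rule order_tendstoD)
    then show "\<forall>\<^sub>F n in sequentially. dist (X n) a < e"
      by eventually_elim (metis X dist_commute less_trans)
  qed
  show thesis
    using p by (intro that[of "fst \<circ> p" "snd \<circ> p"] lim) simp_all
qed

text \<open>Otherwise there are pairs of distinct members tending to \<open>A0\<close> with equal
  images. Compactness gives limits of both frames and of the unit secants; the limit secant has norm
  1 but lies in the trivial kernel of \<open>chart_entries_kernel\<close>.\<close>

lemma spectral_type_locally_injective:
  fixes A0 :: "real^'n^'n"
  assumes A0: "A0 \<in> spectral_type b" and P0: "orthogonal_matrix P0" "A0 ** P0 = P0 ** diag_matrix v0"
    and v0: "\<And>i j. v0 i = v0 j \<longleftrightarrow> b i = b j"
    and f: "linear f" "\<And>M i j. (i, j) \<in> chart_entries b \<Longrightarrow> f M $ i $ j = (transpose P0 ** M ** P0) $ i $ j"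
  shows "\<exists>e>0. inj_on (f :: _ \<Rightarrow> real^'n^'n) (spectral_type b \<inter> ball A0 e)"
proof (rule ccontr)
  assume contra: "\<not> ?thesis"
  obtain A B where A: "\<And>n. A n \<in> spectral_type b" and B: "\<And>n. B n \<in> spectral_type b"
    and ne: "\<And>n. A n \<noteq> B n" and fAB: "\<And>n. f (A n) = f (B n)" and lim: "A \<longlonglongrightarrow> A0" "B \<longlonglongrightarrow> A0"
    by (rule not_locally_injective_sequences[OF contra]) (rule that)
  obtain P v where P: "\<And>n. orthogonal_matrix (P n)" "\<And>n. A n ** P n = P n ** diag_matrix (v n)"
      "\<And>n i j. v n i = v n j \<longleftrightarrow> b i = b j"
    using A unfolding spectral_type_def by simp metis
  obtain Q w where Q: "\<And>n. orthogonal_matrix (Q n)" "\<And>n. B n ** Q n = Q n ** diag_matrix (w n)"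
      "\<And>n i j. w n i = w n j \<longleftrightarrow> b i = b j"
    using B unfolding spectral_type_def by simp metis
  define t where "t n = norm (A n - B n)" for n
  define H where "H n = (1 / t n) *\<^sub>R (A n - B n)" for n
  have t: "t n \<noteq> 0" for n using ne by (simp add: t_def)
  have AB: "A n - B n = t n *\<^sub>R H n" for n using t by (simp add: H_def)
  have nH: "norm (H n) = 1" for n using t[of n] by (simp add: H_def t_def)
  let ?O = "{Q::real^'n^'n. orthogonal_matrix Q}"
  let ?K = "?O \<times> ?O \<times> sphere (0::real^'n^'n) 1"
  have K: "seq_compact ?K"
    unfolding seq_compact_eq_compact
    by (intro compact_Times compact_orthogonal_matrices compact_sphere)
  have mem: "\<forall>n. (P n, Q n, H n) \<in> ?K" using P(1) Q(1) nH by simp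
  obtain L r where L: "L \<in> ?K" and r: "strict_mono r"
    and rL: "((\<lambda>n. (P n, Q n, H n)) \<circ> r) \<longlonglongrightarrow> L"
    by (rule seq_compactE[OF K mem])
  obtain P1 Q1 H1 where L_eq: "L = (P1, Q1, H1)" by (cases L)
  have lims: "(\<lambda>n. P (r n)) \<longlonglongrightarrow> P1" "(\<lambda>n. Q (r n)) \<longlonglongrightarrow> Q1" "(\<lambda>n. H (r n)) \<longlonglongrightarrow> H1"
    using tendsto_fst[OF rL] tendsto_fst[OF tendsto_snd[OF rL]] tendsto_snd[OF tendsto_snd[OF rL]]
    by (simp_all add: L_eq o_def)
  have limAB: "(\<lambda>n. A (r n)) \<longlonglongrightarrow> A0" "(\<lambda>n. B (r n)) \<longlonglongrightarrow> A0"
    using LIMSEQ_subseq_LIMSEQ[OF lim(1) r] LIMSEQ_subseq_LIMSEQ[OF lim(2) r]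
    by (simp_all add: o_def)
  have nH1: "norm H1 = 1" using L by (simp add: L_eq)
  have "\<forall>c. \<exists>h. \<forall>x y. A0 *v x = c *\<^sub>R x \<longrightarrow> A0 *v y = c *\<^sub>R y \<longrightarrow> x \<bullet> (H1 *v y) = h * (x \<bullet> y)"
    using spectral_type_secant_limit[of "\<lambda>n. P (r n)" "\<lambda>n. A (r n)" "\<lambda>n. v (r n)" b
        "\<lambda>n. Q (r n)" "\<lambda>n. B (r n)" "\<lambda>n. w (r n)" A0 P1 Q1 "\<lambda>n. t (r n)" "\<lambda>n. H (r n)" H1,
        OF P(1) P(2) P(3) Q(1) Q(2) Q(3) A0 limAB lims(1,2) t AB lims(3)] by (intro allI)
  then obtain h where h: "\<And>c x y. A0 *v x = c *\<^sub>R x \<Longrightarrow> A0 *v y = c *\<^sub>R y \<Longrightarrow> x \<bullet> (H1 *v y) = h c * (x \<bullet> y)"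
    unfolding choice_iff by blast
  let ?E = "transpose P0 ** H1 ** P0"
  have sym: "transpose H1 = H1"
  proof -
    have "transpose (H n) = H n" for n
      using diagonalized_symmetric[OF P(1,2)] diagonalized_symmetric[OF Q(1,2)]
      by (simp add: H_def bounded_linear.linear[OF bounded_linear_transpose] linear_diff linear_scale)
    then show ?thesis using LIMSEQ_unique[OF tendsto_transpose[OF lims(3)]] lims(3) by simp
  qed
  have "?E = 0"
  proof (rule chart_entries_kernel)
    have E: "transpose ?E = ?E" by (simp add: matrix_transpose_mul sym matrix_mul_assoc)
    have "transpose X $ i $ j = X $ j $ i" for X :: "real^'n^'n" and i j by (simp add: transpose_def)
    from this[of ?E, unfolded E] show "?E $ j $ i = ?E $ i $ j" for i j by (rule HOL.sym)
    \<comment> \<open>The scalar from the secant limit depends on the eigenvalue; evaluating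
      \<open>v0\<close> at the representative turns it into a function of the label.\<close>
    show "?E $ i $ j = h (v0 (inv_into UNIV b (b i))) * (if i = j then 1 else 0)" if "b i = b j" for i j
    proof -
      have "v0 (inv_into UNIV b (b i)) = v0 i" by (simp add: v0 f_inv_into_f)
      moreover have "column i P0 \<bullet> (H1 *v column j P0) = h (v0 i) * (column i P0 \<bullet> column j P0)"
        using diagonalized_column[OF P0(2)] v0 that by (intro h) auto
      moreover have "column i P0 \<bullet> column j P0 = (if i = j then 1 else 0)"
        using P0(1) by (auto simp: orthogonal_matrix_orthonormal_columns norm_eq_1 orthogonal_def)
      ultimately show ?thesis by (simp add: conjugated_entry)
    qed
    show "?E $ i $ j = 0" if "(i, j) \<in> chart_entries b" for i j
    proof -
      have "f (H n) = 0" for n using f(1) fAB by (simp add: H_def linear_diff linear_scale)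
      moreover have "(\<lambda>n. f (H (r n))) \<longlonglongrightarrow> f H1"
        using bounded_linear.tendsto f(1) lims(3) linear_conv_bounded_linear by blast
      ultimately have "f H1 = 0" by (simp add: LIMSEQ_const_iff)
      then show ?thesis using f(2)[OF that, of H1] by simp
    qed
  qed
  then have "P0 ** ?E ** transpose P0 = 0" by (simp add: vec_eq_iff matrix_matrix_mult_def)
  moreover have "P0 ** ?E ** transpose P0 = H1"
    using P0(1) by (simp add: orthogonal_matrix_def flip: matrix_mul_assoc)
  ultimately have "H1 = 0" by simp
  then show False using nH1 by simp
qed

section \<open>A chart from the Cayley transform\<close>

definition resolvent :: "real^'n^'n \<Rightarrow> real^'n^'n" where
  "resolvent K = matrix_inv (mat 1 - K)"

text \<open>This equals \<open>(1 + K)\<close> times the inverse of \<open>1 - K\<close>. In the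
  present form a difference of Cayley transforms is twice a difference of resolvents, to which
  \<open>resolvent_identity\<close> applies.\<close>

definition cayley :: "real^'n^'n \<Rightarrow> real^'n^'n" where
  "cayley K = 2 *\<^sub>R resolvent K - mat 1"

text \<open>Skewness gives \<open>x \<bullet> (K *v x) = 0\<close>, so \<open>K *v x = x\<close>
  forces \<open>x = 0\<close>.\<close>

lemma skew_invertible:
  fixes K :: "real^'n^'n"
  assumes "transpose K = - K"
  shows "invertible (mat 1 - K)"
proof -
  have "x = 0" if "(mat 1 - K) *v x = 0" for x
  proof -
    have x: "K *v x = x" using that by (simp add: matrix_vector_mult_diff_rdistrib)
    have "x \<bullet> (K *v x) = (transpose K *v x) \<bullet> x"
      by (metis dot_lmul_matrix transpose_matrix_vector)
    also have "\<dots> = - ((K *v x) \<bullet> x)"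
      unfolding assms using matrix_vector_mult_diff_rdistrib[of 0 K x] by simp
    finally show ?thesis using x by simp
  qed
  then have "\<exists>B. B ** (mat 1 - K) = mat 1" unfolding matrix_left_invertible_ker by blast
  then show ?thesis unfolding invertible_def using matrix_left_right_inverse by blast
qed

lemma resolvent_inverse:
  assumes "transpose K = - K"
  shows "(mat 1 - K) ** resolvent K = mat 1" "resolvent K ** (mat 1 - K) = mat 1"
  using someI_ex[OF skew_invertible[OF assms, unfolded invertible_def]]
  by (auto simp: resolvent_def matrix_inv_def)

lemma resolvent_identity:
  assumes "transpose K = - K" "transpose L = - L"
  shows "resolvent K - resolvent L = resolvent L ** (K - L) ** resolvent K"
proof -
  have "resolvent L ** (K - L) ** resolvent K
      = resolvent L ** ((mat 1 - L) - (mat 1 - K)) ** resolvent K" by simp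
  also have "\<dots> = (resolvent L ** (mat 1 - L)) ** resolvent K
      - resolvent L ** ((mat 1 - K) ** resolvent K)"
    by (simp only: matrix_mult_diff_left matrix_mult_diff_right matrix_mul_assoc)
  finally show ?thesis by (simp add: resolvent_inverse assms)
qed

text \<open>Writing \<open>2 = (1 + K) + (1 - K)\<close> between \<open>transpose R\<close> and
  \<open>R\<close>, for the resolvent \<open>R\<close>, yields
  \<open>2 * transpose R * R = R + transpose R\<close>, exactly the relation that makes the mixed
  terms cancel.\<close>

lemma orthogonal_cayley:
  fixes K :: "real^'n^'n"
  assumes K: "transpose K = - K"
  shows "orthogonal_matrix (cayley K)"
proof -
  let ?R = "resolvent K" and ?I = "mat 1 :: real^'n^'n"
  have "transpose ((?I - K) ** ?R) = ?I" by (simp add: resolvent_inverse K)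
  then have t: "transpose ?R ** (?I + K) = ?I"
    by (simp add: matrix_transpose_mul linear_diff[OF bounded_linear.linear[OF bounded_linear_transpose]] K)
  have "transpose ?R ** ((?I + K) + (?I - K)) ** ?R = ?R + transpose ?R"
    using t resolvent_inverse(1)[OF K]
    by (simp only: matrix_mult_add_right matrix_mult_add_left matrix_mul_assoc[symmetric])
       (simp add: matrix_mul_assoc)
  moreover have "(?I + K) + (?I - K) = 2 *\<^sub>R ?I" by (simp add: scaleR_2)
  ultimately have RR: "2 *\<^sub>R (transpose ?R ** ?R) = ?R + transpose ?R"
    by (simp add: matrix_mult_scaleR_left matrix_mult_scaleR_right)
  have "transpose (cayley K) = 2 *\<^sub>R transpose ?R - ?I"
    unfolding cayley_def
    by (simp add: bounded_linear.linear[OF bounded_linear_transpose] linear_diff linear_scale)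
  then have "transpose (cayley K) ** cayley K = (2 *\<^sub>R transpose ?R - ?I) ** (2 *\<^sub>R ?R - ?I)"
    by (simp only: cayley_def)
  also have "\<dots> = 2 *\<^sub>R (2 *\<^sub>R (transpose ?R ** ?R)) - 2 *\<^sub>R (?R + transpose ?R) + ?I"
    by (simp add: matrix_mult_diff_left matrix_mult_diff_right matrix_mult_scaleR_left
        matrix_mult_scaleR_right algebra_simps)
  finally show ?thesis by (simp add: RR orthogonal_matrix)
qed

text \<open>Twice the resolvent is an orthogonal matrix plus the identity.\<close>

lemma resolvent_bounded:
  obtains C where "\<And>K::real^'n^'n. transpose K = - K \<Longrightarrow> norm (resolvent K) \<le> C"
proof -
  obtain C where C: "\<And>P::real^'n^'n. orthogonal_matrix P \<Longrightarrow> norm P \<le> C"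
    using compact_imp_bounded[OF compact_orthogonal_matrices] unfolding bounded_iff by blast
  have "norm (resolvent K) \<le> (C + norm (mat 1 :: real^'n^'n)) / 2"
    if "transpose K = - K" for K :: "real^'n^'n"
  proof -
    have "2 * norm (resolvent K) = norm (cayley K + mat 1)" by (simp add: cayley_def)
    also have "\<dots> \<le> C + norm (mat 1 :: real^'n^'n)"
      using norm_triangle_ineq C[OF orthogonal_cayley[OF that]] by (meson add_right_mono order_trans)
    finally show ?thesis by simp
  qed
  then show thesis by (rule that)
qed

text \<open>In the resolvent identity one factor tends to zero while the other stays
  bounded.\<close>

lemma tendsto_resolvent:
  fixes K :: "'a \<Rightarrow> real^'n^'n"
  assumes K: "(K \<longlongrightarrow> L) F" "\<And>x. transpose (K x) = - K x" and L: "transpose L = - L"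
  shows "((\<lambda>x. resolvent (K x)) \<longlongrightarrow> resolvent L) F"
proof -
  obtain C where C: "\<And>K::real^'n^'n. transpose K = - K \<Longrightarrow> norm (resolvent K) \<le> C"
    using resolvent_bounded by blast
  have "((\<lambda>x. resolvent L ** (K x - L)) \<longlongrightarrow> resolvent L ** (L - L)) F"
    by (intro tendsto_intros K)
  then have "Zfun (\<lambda>x. resolvent L ** (K x - L)) F" by (simp add: tendsto_Zfun_iff matrix_mult_diff_right)
  moreover have "Bfun (\<lambda>x. resolvent (K x)) F"
    using C K(2) by (intro BfunI[of _ C]) (simp add: always_eventually)
  ultimately have "Zfun (\<lambda>x. resolvent L ** (K x - L) ** resolvent (K x)) F"
    by (rule bounded_bilinear.Zfun_prod_Bfun[OF bounded_bilinear_matrix_mult])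
  then show ?thesis by (simp add: tendsto_Zfun_iff resolvent_identity[OF K(2) L])
qed

section \<open>The chart around a diagonal matrix with the labels as eigenvalues\<close>

text \<open>Together with \<open>block_part\<close> this decodes a parameter matrix: entries with
  \<open>b i < b j\<close> generate the rotation, and the entry at a fibre's representative shifts
  the eigenvalue of the whole fibre.\<close>

definition skew_part :: "('n::finite \<Rightarrow> nat) \<Rightarrow> real^'n^'n \<Rightarrow> real^'n^'n" where
  "skew_part b M = (\<chi> i j. if b i < b j then M $ i $ j else if b j < b i then - M $ j $ i else 0)"

definition block_part :: "('n::finite \<Rightarrow> nat) \<Rightarrow> real^'n^'n \<Rightarrow> 'n \<Rightarrow> real" where
  "block_part b M i = M $ inv_into UNIV b (b i) $ inv_into UNIV b (b i)"

definition spectral_chart :: "('n::finite \<Rightarrow> nat) \<Rightarrow> real^'n^'n \<Rightarrow> real^'n^'n" where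
  "spectral_chart b M = cayley (skew_part b M) ** diag_matrix (\<lambda>i. real (b i) + block_part b M i) **
     transpose (cayley (skew_part b M))"

lemma transpose_skew_part: "transpose (skew_part b M) = - skew_part b M"
  by (auto simp: skew_part_def transpose_def vec_eq_iff)

lemma bounded_linear_skew_part: "bounded_linear (skew_part b)"
  unfolding linear_conv_bounded_linear [symmetric]
  by (auto intro!: linearI simp: skew_part_def vec_eq_iff)

lemma bounded_linear_block_part: "bounded_linear (\<lambda>M. diag_matrix (block_part b M) :: real^'n^'n)"
  unfolding linear_conv_bounded_linear [symmetric]
  by (auto intro!: linearI simp: block_part_def vec_eq_iff)

lemma diag_matrix_add: "diag_matrix (\<lambda>i. v i + w i) = diag_matrix v + (diag_matrix w :: real^'n^'n)"
  by (simp add: vec_eq_iff)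

lemma tendsto_cayley_skew_part:
  assumes "(M \<longlongrightarrow> M0) F"
  shows "((\<lambda>x. cayley (skew_part b (M x))) \<longlongrightarrow> cayley (skew_part b M0)) F"
  unfolding cayley_def
  by (intro tendsto_intros tendsto_resolvent transpose_skew_part
      bounded_linear.tendsto[OF bounded_linear_skew_part] assms)

lemma tendsto_spectral_chart:
  assumes "(M \<longlongrightarrow> M0) F"
  shows "((\<lambda>x. spectral_chart b (M x)) \<longlongrightarrow> spectral_chart b M0) F"
  unfolding spectral_chart_def diag_matrix_add
  by (intro tendsto_intros tendsto_cayley_skew_part
      bounded_linear.tendsto[OF bounded_linear_block_part] assms)

lemma spectral_chart_diagonalized:
  "spectral_chart b M ** cayley (skew_part b M) =
     cayley (skew_part b M) ** diag_matrix (\<lambda>i. real (b i) + block_part b M i)"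
  using orthogonal_cayley[OF transpose_skew_part, of b M]
  by (simp add: spectral_chart_def orthogonal_matrix_def flip: matrix_mul_assoc)

lemma cayley_zero [simp]: "cayley 0 = mat 1"
  using resolvent_inverse(1)[of 0] by (simp add: cayley_def transpose_def vec_eq_iff scaleR_2)

lemma spectral_chart_zero: "spectral_chart b 0 = diag_matrix (\<lambda>i. real (b i))"
proof -
  have "skew_part b 0 = 0" by (simp add: skew_part_def vec_eq_iff)
  then show ?thesis by (simp add: spectral_chart_def block_part_def)
qed

text \<open>Distinct labels differ by at least 1, so shifts below \<open>1 / 2\<close> cannot make
  eigenvalues of different fibres collide.\<close>

lemma spectral_chart_in_spectral_type:
  fixes M :: "real^'n^'n"
  assumes "norm M < 1 / 2"
  shows "spectral_chart b M \<in> spectral_type b"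
proof -
  have small: "\<bar>block_part b M i\<bar> < 1 / 2" for i
    unfolding block_part_def
    by (rule le_less_trans[OF order_trans[OF component_le_norm_cart Finite_Cartesian_Product.norm_nth_le] assms])
  have "(real (b i) + block_part b M i = real (b j) + block_part b M j) \<longleftrightarrow> b i = b j" for i j
  proof
    assume "real (b i) + block_part b M i = real (b j) + block_part b M j"
    then have "\<bar>real (b i) - real (b j)\<bar> < 1" using small[of i] small[of j] by linarith
    then show "b i = b j" by linarith
  next
    assume "b i = b j"
    then show "real (b i) + block_part b M i = real (b j) + block_part b M j" by (simp add: block_part_def)
  qed
  then show ?thesis
    unfolding spectral_type_def
    using orthogonal_cayley[OF transpose_skew_part] spectral_chart_diagonalized by blast
qed

text \<open>Limits of normalised secants take the place of the derivative at 0, whose kernel on the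
  supported matrices is trivial.\<close>

lemma spectral_chart_locally_injective:
  fixes b :: "'n::finite \<Rightarrow> nat"
  shows "\<exists>e>0. inj_on (spectral_chart b :: real^'n^'n \<Rightarrow> _) (supported_matrices (chart_entries b) \<inter> ball 0 e)"
proof (rule ccontr)
  let ?W = "supported_matrices (chart_entries b) :: (real^'n^'n) set"
  let ?f = "spectral_chart b :: real^'n^'n \<Rightarrow> _"
  let ?R = "\<lambda>M. resolvent (skew_part b M) :: real^'n^'n"
  let ?P = "\<lambda>M. cayley (skew_part b M) :: real^'n^'n"
  let ?\<Delta> = "\<lambda>M. diag_matrix (block_part b M) :: real^'n^'n"
  let ?D0 = "diag_matrix (\<lambda>i. real (b i)) :: real^'n^'n"
  assume "\<not> ?thesis"
  then obtain M N where W: "\<And>n. M n \<in> ?W" "\<And>n. N n \<in> ?W" and ne: "\<And>n. M n \<noteq> N n"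
    and eq: "\<And>n. ?f (M n) = ?f (N n)" and lim: "M \<longlonglongrightarrow> 0" "N \<longlonglongrightarrow> 0"
    by (rule not_locally_injective_sequences) (rule that)
  define t where "t n = norm (M n - N n)" for n
  define H where "H n = (1 / t n) *\<^sub>R (M n - N n)" for n
  have t: "t n \<noteq> 0" for n using ne by (simp add: t_def)
  have MN: "M n - N n = t n *\<^sub>R H n" for n using t by (simp add: H_def)
  have nH: "norm (H n) = 1" for n using t[of n] by (simp add: H_def t_def)
  have HW: "H n \<in> ?W" for n
    unfolding H_def by (intro subspace_scale subspace_diff subspace_supported_matrices W)
  have "seq_compact (?W \<inter> sphere 0 1)"
    unfolding seq_compact_eq_compact
    by (simp add: closed_Int_compact closed_subspace subspace_supported_matrices)
  moreover have "\<forall>n. H n \<in> ?W \<inter> sphere 0 1" using HW nH by simp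
  ultimately obtain H1 r where H1: "H1 \<in> ?W \<inter> sphere 0 1" and r: "strict_mono r" and rH: "(H \<circ> r) \<longlonglongrightarrow> H1"
    by (rule seq_compactE)
  have limr: "(\<lambda>n. H (r n)) \<longlonglongrightarrow> H1" "(\<lambda>n. M (r n)) \<longlonglongrightarrow> 0" "(\<lambda>n. N (r n)) \<longlonglongrightarrow> 0"
    using rH LIMSEQ_subseq_LIMSEQ[OF lim(1) r] LIMSEQ_subseq_LIMSEQ[OF lim(2) r] by (simp_all add: o_def)
  \<comment> \<open>A discrete product rule: subtract the relations \<open>F P = P D\<close> at
    \<open>M n\<close> and \<open>N n\<close>, where \<open>F\<close> agrees, and divide by
    \<open>t n\<close>. The factor in \<open>2 *\<^sub>R\<close> is the difference quotient of the
    Cayley transforms.\<close>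
  have secant: "?f (M n) ** (2 *\<^sub>R (?R (N n) ** skew_part b (H n) ** ?R (M n)))
      = (2 *\<^sub>R (?R (N n) ** skew_part b (H n) ** ?R (M n))) ** (?D0 + ?\<Delta> (M n)) + ?P (N n) ** ?\<Delta> (H n)" for n
  proof -
    let ?G = "2 *\<^sub>R (?R (N n) ** skew_part b (H n) ** ?R (M n))"
    have "skew_part b (M n) - skew_part b (N n) = t n *\<^sub>R skew_part b (H n)"
      by (simp only: linear_diff[OF bounded_linear.linear[OF bounded_linear_skew_part], symmetric] MN
          linear_scale[OF bounded_linear.linear[OF bounded_linear_skew_part]])
    then have sk: "?R (M n) - ?R (N n) = ?R (N n) ** (t n *\<^sub>R skew_part b (H n)) ** ?R (M n)"
      by (simp only: resolvent_identity[OF transpose_skew_part transpose_skew_part])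
    have "?P (M n) - ?P (N n) = 2 *\<^sub>R (?R (M n) - ?R (N n))"
      by (simp add: cayley_def scaleR_diff_right)
    then have PP: "?P (M n) - ?P (N n) = t n *\<^sub>R ?G"
      unfolding sk by (simp add: matrix_mult_scaleR_left matrix_mult_scaleR_right)
    have DD: "?\<Delta> (M n) - ?\<Delta> (N n) = t n *\<^sub>R ?\<Delta> (H n)"
      by (simp only: linear_diff[OF bounded_linear.linear[OF bounded_linear_block_part], symmetric] MN
          linear_scale[OF bounded_linear.linear[OF bounded_linear_block_part]])
    have d: "?f X ** ?P X = ?P X ** (?D0 + ?\<Delta> X)" for X
      by (simp only: diag_matrix_add[symmetric] spectral_chart_diagonalized)
    note dM = d[of "M n"] and dN = d[of "N n", folded eq]
    have "t n *\<^sub>R (?f (M n) ** ?G) = ?f (M n) ** (?P (M n) - ?P (N n))"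
      by (simp only: PP matrix_mult_scaleR_right)
    also have "\<dots> = (?P (M n) - ?P (N n)) ** (?D0 + ?\<Delta> (M n)) + ?P (N n) ** (?\<Delta> (M n) - ?\<Delta> (N n))"
      by (simp add: matrix_mult_diff_right matrix_mult_diff_left matrix_mult_add_right dM dN)
    also have "\<dots> = t n *\<^sub>R (?G ** (?D0 + ?\<Delta> (M n)) + ?P (N n) ** ?\<Delta> (H n))"
      by (simp only: PP DD matrix_mult_scaleR_left matrix_mult_scaleR_right scaleR_add_right)
    finally show ?thesis using t[of n] by simp
  qed
  have z: "skew_part b 0 = 0" "?\<Delta> 0 = 0" by (simp_all add: skew_part_def block_part_def vec_eq_iff)
  have R0: "resolvent 0 = (mat 1 :: real^'n^'n)" using resolvent_inverse(1)[of 0] by (simp add: transpose_def vec_eq_iff)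
  have R: "(\<lambda>n. ?R (X n)) \<longlonglongrightarrow> mat 1" if "X \<longlonglongrightarrow> 0" for X
    using tendsto_resolvent[OF bounded_linear.tendsto[OF bounded_linear_skew_part[of b] that] transpose_skew_part transpose_skew_part]
    by (simp add: z R0)
  have G: "(\<lambda>n. 2 *\<^sub>R (?R (N (r n)) ** skew_part b (H (r n)) ** ?R (M (r n)))) \<longlonglongrightarrow> 2 *\<^sub>R (mat 1 ** skew_part b H1 ** mat 1)"
    by (intro tendsto_intros R limr bounded_linear.tendsto[OF bounded_linear_skew_part])
  have lhs: "(\<lambda>n. ?f (M (r n)) ** (2 *\<^sub>R (?R (N (r n)) ** skew_part b (H (r n)) ** ?R (M (r n)))))
      \<longlonglongrightarrow> ?f 0 ** 2 *\<^sub>R (mat 1 ** skew_part b H1 ** mat 1)"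
    by (intro tendsto_matrix_mult G tendsto_spectral_chart limr)
  have rhs: "(\<lambda>n. 2 *\<^sub>R (?R (N (r n)) ** skew_part b (H (r n)) ** ?R (M (r n))) ** (?D0 + ?\<Delta> (M (r n)))
          + ?P (N (r n)) ** ?\<Delta> (H (r n)))
      \<longlonglongrightarrow> 2 *\<^sub>R (mat 1 ** skew_part b H1 ** mat 1) ** (?D0 + ?\<Delta> 0) + ?P 0 ** ?\<Delta> H1"
    by (intro tendsto_add tendsto_const tendsto_matrix_mult G tendsto_cayley_skew_part
        bounded_linear.tendsto[OF bounded_linear_block_part] limr)
  have "?D0 ** (2 *\<^sub>R skew_part b H1) = (2 *\<^sub>R skew_part b H1) ** ?D0 + ?\<Delta> H1"
    using LIMSEQ_unique[OF lhs rhs[folded secant]] by (simp add: z spectral_chart_zero)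
  then have "(?D0 ** (2 *\<^sub>R skew_part b H1)) $ i $ j = ((2 *\<^sub>R skew_part b H1) ** ?D0 + ?\<Delta> H1) $ i $ j" for i j
    by simp
  \<comment> \<open>Off the diagonal this reads \<open>(b i - b j) * K $ i $ j = 0\<close> for the
    skew part \<open>K\<close>, so entries between different fibres vanish; on the diagonal the
    \<open>K\<close> terms cancel and leave the block part.\<close>
  then have entry: "real (b i) * (2 * skew_part b H1 $ i $ j)
      = 2 * skew_part b H1 $ i $ j * real (b j) + (if i = j then block_part b H1 i else 0)" for i j
    by (simp add: matrix_mult_diag_left matrix_mult_diag_right)
  have "H1 $ i $ j = 0" for i j
  proof (cases "(i, j) \<in> chart_entries b")
    case True
    then consider "b i < b j" | "i = j" "inv_into UNIV b (b i) = i" by (auto simp: chart_entries_def)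
    then show ?thesis
    proof cases
      case 1
      then have "i \<noteq> j" "skew_part b H1 $ i $ j = H1 $ i $ j" by (auto simp: skew_part_def)
      then show ?thesis using entry[of i j] 1 by (auto simp: mult.commute)
    next
      case 2
      then show ?thesis using entry[of i i] by (simp add: skew_part_def block_part_def)
    qed
  next
    case False
    then show ?thesis using H1 by (simp add: supported_matrices_def)
  qed
  then have "H1 = 0" by (simp add: vec_eq_iff)
  then show False using H1 by simp
qed

section \<open>The dimension\<close>

theorem real_dim_spectral_type:
  fixes b :: "'n::finite \<Rightarrow> nat"
  shows "real_dim (spectral_type b) = card (chart_entries b)"
proof -
  let ?W = "supported_matrices (chart_entries b) :: (real^'n^'n) set"
  obtain e where e: "e > 0" "inj_on (spectral_chart b) (?W \<inter> ball 0 e)"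
    using spectral_chart_locally_injective by blast
  \<comment> \<open>The factor 1/2 keeps the closed ball inside the ball of injectivity, and 1/4
    keeps its matrices below the norm bound for membership.\<close>
  define r where "r = min (e / 2) (1 / 4)"
  have r: "r > 0" "r < e" "r < 1 / 2" using e(1) by (auto simp: r_def)
  show ?thesis
  proof (rule real_dim_eqI[OF _ _ subspace_supported_matrices dim_supported_matrices])
    show "spectral_chart b ` (?W \<inter> ball 0 r) \<subseteq> spectral_type b"
      using r(3) by (auto intro!: spectral_chart_in_spectral_type)
    have "continuous_on (?W \<inter> cball 0 r) (spectral_chart b)"
      unfolding continuous_on_def by (intro ballI tendsto_spectral_chart tendsto_ident_at)
    moreover have "inj_on (spectral_chart b) (?W \<inter> cball 0 r)"
      using e(2) by (rule inj_on_subset) (use r(2) in auto)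
    ultimately show "top_of_set (spectral_chart b ` (?W \<inter> ball 0 r))
        homeomorphic_space Euclidean_space (card (chart_entries b))"
      using injective_image_ball_homeomorphic_Euclidean_space[OF subspace_supported_matrices r(1)]
      unfolding dim_supported_matrices by blast
  next
    fix A :: "real^'n^'n" assume A: "A \<in> spectral_type b"
    then obtain P v where P: "orthogonal_matrix P" "A ** P = P ** diag_matrix v"
      and v: "\<And>i j. v i = v j \<longleftrightarrow> b i = b j" unfolding spectral_type_def by blast
    \<comment> \<open>The local injection depends on the base point through its frame
      \<open>P\<close>: conjugate, then keep only the chart entries.\<close>
    define f :: "real^'n^'n \<Rightarrow> real^'n^'n" where
      "f M = (\<chi> i j. if (i, j) \<in> chart_entries b then (transpose P ** M ** P) $ i $ j else 0)" for M
    have f: "linear f"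
      by (auto intro!: linearI simp: f_def vec_eq_iff matrix_mult_add_left matrix_mult_add_right
          matrix_mult_scaleR_left matrix_mult_scaleR_right)
    obtain e where e: "e > 0" "inj_on f (spectral_type b \<inter> ball A e)"
      using spectral_type_locally_injective[OF A P v f] by (auto simp: f_def)
    have "openin (top_of_set (spectral_type b)) (spectral_type b \<inter> ball A e)"
      by (simp add: openin_open_Int)
    moreover have "A \<in> spectral_type b \<inter> ball A e" using A e(1) by simp
    moreover have "continuous_on (spectral_type b \<inter> ball A e) f"
      using f by (simp add: linear_continuous_on linear_conv_bounded_linear)
    moreover have "f ` (spectral_type b \<inter> ball A e) \<subseteq> ?W"
      by (auto simp: f_def supported_matrices_def)
    ultimately show "\<exists>U f. openin (top_of_set (spectral_type b)) U \<and> A \<in> U \<and>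
        continuous_on U f \<and> f ` U \<subseteq> ?W \<and> inj_on f U"
      using e(2) by blast
  qed
qed

section \<open>Counting positions and assembling the formula\<close>

lemma card_chart_entries:
  "card (chart_entries b) = card {(i, j). b i < b j} + card (range b)"
proof -
  let ?d = "\<lambda>c. (inv_into UNIV b c, inv_into UNIV b c)"
  have "chart_entries b = {(i, j). b i < b j} \<union> ?d ` range b"
  proof safe
    fix i j assume "(i, j) \<in> chart_entries b" "(i, j) \<notin> ?d ` range b"
    moreover from this have "b i < b j \<or> (i, j) = ?d (b i)" by (auto simp: chart_entries_def)
    ultimately show "b i < b j" by blast
  qed (simp_all add: chart_entries_def f_inv_into_f)
  moreover have "{(i, j). b i < b j} \<inter> ?d ` range b = {}" by auto
  moreover have "card (?d ` range b) = card (range b)"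
    by (intro card_image inj_on_inverseI[of _ "\<lambda>p. b (fst p)"]) (simp add: f_inv_into_f)
  ultimately show ?thesis by (simp add: card_Un_disjoint)
qed

text \<open>The index type is put in bijection with the disjoint union of the sets
  \<open>{..<k i}\<close>, and \<open>b\<close> reads off the summand. Positivity makes every label
  occur.\<close>

lemma ex_partition_with_cards:
  fixes k :: "nat \<Rightarrow> nat"
  assumes pos: "\<And>i. i \<in> {1..m} \<Longrightarrow> 0 < k i" and sum: "(\<Sum>i=1..m. k i) = CARD('n)"
  obtains b :: "'n::finite \<Rightarrow> nat" where "range b = {1..m}" "\<And>i. i \<in> {1..m} \<Longrightarrow> card {a. b a = i} = k i"
proof -
  let ?S = "SIGMA i:{1..m}. {..<k i}"
  have "card ?S = CARD('n)" using sum by simp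
  then obtain h where h: "bij_betw h (UNIV :: 'n set) ?S"
    using finite_same_card_bij[of "UNIV :: 'n set" ?S] by auto
  define b where "b a = fst (h a)" for a
  have fibre: "card {a. b a = i} = k i" if "i \<in> {1..m}" for i
  proof -
    have "h ` {a. b a = i} = {i} \<times> {..<k i}"
    proof
      show "h ` {a. b a = i} \<subseteq> {i} \<times> {..<k i}"
      proof
        fix x assume "x \<in> h ` {a. b a = i}"
        then have "x \<in> ?S" "fst x = i" using h by (auto simp: bij_betw_def b_def)
        then show "x \<in> {i} \<times> {..<k i}" by (cases x) auto
      qed
      show "{i} \<times> {..<k i} \<subseteq> h ` {a. b a = i}"
      proof
        fix x assume x: "x \<in> {i} \<times> {..<k i}"
        then have "x \<in> range h" using h that by (auto simp: bij_betw_def)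
        then obtain a where "x = h a" by blast
        then show "x \<in> h ` {a. b a = i}" using x by (intro image_eqI[of _ _ a]) (auto simp: b_def)
      qed
    qed
    moreover have "inj_on h {a. b a = i}" using h by (auto simp: bij_betw_def inj_on_def)
    ultimately have "card {a. b a = i} = card ({i} \<times> {..<k i})" by (metis card_image)
    then show ?thesis by simp
  qed
  have "h a \<in> ?S" for a using h by (auto simp: bij_betw_def)
  moreover have "fst x \<in> {1..m}" if "x \<in> ?S" for x using that by (cases x) auto
  ultimately have "range b \<subseteq> {1..m}" unfolding b_def by blast
  moreover have "{1..m} \<subseteq> range b"
  proof
    fix i assume i: "i \<in> {1..m}"
    then have "{a. b a = i} \<noteq> {}" using fibre[OF i] pos[OF i] by (metis card.empty less_irrefl)
    then show "i \<in> range b" by blast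
  qed
  ultimately show thesis using that fibre by blast
qed

lemma card_same_block_pairs:
  fixes b :: "'n::finite \<Rightarrow> nat"
  assumes "range b = {1..m}" and k: "\<And>i. i \<in> {1..m} \<Longrightarrow> card {a. b a = i} = k i"
  shows "card {(i, j). b i = b j} = (\<Sum>i=1..m. (k i)\<^sup>2)"
proof -
  have "{(i, j). b i = b j} = (\<Union>c\<in>{1..m}. {a. b a = c} \<times> {a. b a = c})"
    using assms(1) by auto
  also have "card \<dots> = (\<Sum>c=1..m. card ({a. b a = c} \<times> {a. b a = c}))"
    by (intro card_UN_disjoint) auto
  also have "\<dots> = (\<Sum>i=1..m. (k i)\<^sup>2)"
    by (intro sum.cong) (simp_all add: card_cartesian_product k power2_eq_square)
  finally show ?thesis .
qed

theorem corollary5p2: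
  fixes n m :: nat and k :: "nat \<Rightarrow> nat"
  assumes "n = CARD('n)"
    and "\<And>i. i \<in> {1..m} \<Longrightarrow> 0 < k i"
    and "(\<Sum>i=1..m. k i) = n"
  shows "real_codim symmetric_matrices (symmetric_with_multiplicities m k :: (real^'n^'n) set) =
           real n * (real n + 1) / 2 -
           (real n * (real n - 1) / 2 + real m - (\<Sum>i=1..m. real (k i) * (real (k i) - 1) / 2)) \<and>
         real n * (real n + 1) / 2 -
           (real n * (real n - 1) / 2 + real m - (\<Sum>i=1..m. real (k i) * (real (k i) - 1) / 2)) =
         1 / 2 * (\<Sum>i=1..m. (real (k i) + 2) * (real (k i) - 1))"
proof -
  obtain b :: "'n \<Rightarrow> nat" where b: "range b = {1..m}" "\<And>i. i \<in> {1..m} \<Longrightarrow> card {a. b a = i} = k i"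
    using ex_partition_with_cards[where k = k and m = m] assms by metis
  \<comment> \<open>The dimension is \<open>c + m\<close>, and counting all index pairs gives
    \<open>2 * c + s\<close> as the square of \<open>n\<close>; so both equalities reduce to
    arithmetic in \<open>s\<close>, \<open>n\<close> and \<open>m\<close>.\<close>
  define c where "c = card {(i, j). b i < b j}"
  define s where "s = (\<Sum>i=1..m. (real (k i))\<^sup>2)"
  have dim: "real_dim (symmetric_with_multiplicities m k :: (real^'n^'n) set) = c + m"
    using real_dim_spectral_type[of b] card_chart_entries[of b]
      symmetric_with_multiplicities_eq_spectral_type[OF b] b(1)
    by (simp add: c_def)
  have "2 * c + (\<Sum>i=1..m. (k i)\<^sup>2) = n\<^sup>2"
    using card_off_diagonal_pairs[of b] card_same_block_pairs[OF b] assms(1) by (simp add: c_def)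
  then have c: "2 * real c + s = (real n)\<^sup>2"
    unfolding s_def by (simp flip: of_nat_power of_nat_sum of_nat_add of_nat_mult add: of_nat_numeral)
  have sym: "2 * real (dim (symmetric_matrices :: (real^'n^'n) set)) = real n * (real n + 1)"
    using arg_cong[OF dim_symmetric_matrices[where 'n = 'n], of real] assms(1) by (simp add: algebra_simps)
  have n: "(\<Sum>i=1..m. real (k i)) = real n" using assms(3) by (metis of_nat_sum)
  have s1: "(\<Sum>i=1..m. real (k i) * (real (k i) - 1) / 2) = (s - real n) / 2"
    unfolding s_def n[symmetric] sum_divide_distrib[symmetric] sum_subtractf[symmetric]
    by (simp add: power2_eq_square algebra_simps)
  have s2: "(\<Sum>i=1..m. (real (k i) + 2) * (real (k i) - 1)) = s + real n - 2 * real m"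
  proof -
    have "(\<Sum>i=1..m. (real (k i) + 2) * (real (k i) - 1)) = (\<Sum>i=1..m. (real (k i))\<^sup>2 + real (k i) - 2)"
      by (intro sum.cong) (simp_all add: power2_eq_square algebra_simps)
    then show ?thesis unfolding sum_subtractf sum.distrib s_def n by simp
  qed
  have nn: "real n * (real n - 1) / 2 = ((real n)\<^sup>2 - real n) / 2"
    "real n * (real n + 1) / 2 = ((real n)\<^sup>2 + real n) / 2"
    by (simp_all add: power2_eq_square algebra_simps)
  show ?thesis
    unfolding real_codim_def dim s1 s2 nn
    using c sym nn(2) by (simp add: field_simps)
qed

end
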